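(* Let $\beta$ be a generalised multinacci number that is a Pisot number. Then, with respect to the metric $\bar\rho$, the local dimension $d(\mu_\beta,x)$ exists for $\lambda$-a.e. $x\in[0,\frac{\lfloor\beta\rfloor}{\beta-1}]$ and is equal to $$\frac{\log\lceil\beta\rceil-\gamma}{\log\beta},$$ where $\lambda$ is Lebesgue measure and $\gamma=\gamma(\beta)$ is the constant such that $\lim_{k\to\infty}\frac{\log\mathcal N_k(x,\beta)}{k}=\gamma$ for $\lambda$-a.e. $x\in[0,\frac{\lfloor\beta\rfloor}{\beta-1}]$.
   Context: **Generalised multinacci numbers.** For $\beta>1$ let $I=[0,\frac{\lfloor\beta\rfloor}{\beta-1}]$. The greedy map $T_\beta:I\to I$ is $T_\beta x=\beta x-a_1(x)$, where $a_1(x)=k$ if $x\in[\frac k\beta,\frac{k+1}\beta)$ for some $k\in\{0,\dots,\lfloor\beta\rfloor-1\}$, and $a_1(x)=\lfloor\beta\rfloor$ if $x\in[\frac{\lfloor\beta\rfloor}\beta,\frac{\lfloor\beta\rfloor}{\beta-1}]$. With $a_n(x)=a_1(T_\beta^{n-1}x)$ one has $x=\sum_{n\ge1}a_n(x)\beta^{-n}$, the greedy $\beta$-expansion of $x$. The number $\beta$ is a generalised multinacci number if the greedy expansion of $1$ is finite, $1=\frac{a_1}{\beta}+\cdots+\frac{a_n}{\beta^n}$, with $n\ge2$ and $a_j\ge1$ for all $1\le j\le n$. A Pisot number is an algebraic integer $>1$ all of whose other Galois conjugates lie inside the unit circle. **Random $\beta$-transformation.** Let $T_kx=\beta x-k$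 for $0\le k\le\lfloor\beta\rfloor$, and $E_0=[0,\frac1\beta)$, $E_{\lfloor\beta\rfloor}=\big(\frac{\lfloor\beta\rfloor}{\beta(\beta-1)}+\frac{\lfloor\beta\rfloor-1}{\beta},\frac{\lfloor\beta\rfloor}{\beta-1}\big]$, $E_k=\big(\frac{\lfloor\beta\rfloor}{\beta(\beta-1)}+\frac{k-1}\beta,\frac{k+1}\beta\big)$ for $1\le k\le\lfloor\beta\rfloor-1$, $S_k=\big[\frac k\beta,\frac{\lfloor\beta\rfloor}{\beta(\beta-1)}+\frac{k-1}\beta\big]$ for $1\le k\le\lfloor\beta\rfloor$. Put $\Omega=\{0,1\}^{\mathbb N}$, with left shift $\sigma$. Define $K:\Omega\times I\to\Omega\times I$ by $K(\omega,x)=(\omega,T_kx)$ if $x\in E_k$, and $K(\omega,x)=(\sigma\omega,T_{k-1+\omega_1}x)$ if $x\in S_k$. Let $\pi(\omega,x)=x$. **Bernoulli convolution.** $\mu_\beta$ is the symmetric Bernoulli convolution on $I$: the distribution of $\sum_{k\ge1}b_k\beta^{-k}$ with $b_k$ i.i.d. uniform on $\{0,\dots,\lfloor\beta\rfloor\}$. **Coding and metrics.** For $\beta$ generalised multinacci the set $$F=\Big\{\pi(K^n(\omega,1)),\ \pi\big(K^n(\omega,\tfrac{\lfloor\beta\rfloor}{\beta-1}-1)\big):n\ge0,\ \omega\in\Omega\Big\}\cup\Big\{\tfrac k\beta,\ \tfrac{\lfloor\beta\rfloor}{\beta(\beta-1)}+\tfrac k\beta:0\le k\le\lfloor\beta\rfloor\Big\}$$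 is finite (known). Let $C_1,\dots,C_L$ be the open intervals between consecutive points of $F$, numbered from left to right. Let $X=(\Omega\times I)\setminus\bigcup_{n\ge0}K^{-n}(\Omega\times F)$. For $(\omega,x)\in X$ and $j\ge1$ let $\alpha_j(\omega,x)=k$ if $\pi(K^{j-1}(\omega,x))\in C_k$. The two endpoints of $I$ (fixed by the dynamics) are coded by the adjacent intervals: $\alpha_j(\omega,0)=1$ and $\alpha_j(\omega,\frac{\lfloor\beta\rfloor}{\beta-1})=L$ for all $j,\omega$. Let $I^*=\{x\in I:\Omega\times\{x\}\subset X\}\cup\{0,\frac{\lfloor\beta\rfloor}{\beta-1}\}$; its complement in $I$ is countable. On $\Omega\times I^*$ put the metric $$\rho\big((\omega,x),(\omega',x')\big)=\beta^{-\min\{k\ge0:\ \omega_{k+1}\ne\omega'_{k+1}\text{ or }\alpha_{k+1}(\omega,x)\ne\alpha_{k+1}(\omega',x')\}}$$ for distinct points (and $0$ for equal points), with open balls $B_\rho$. On $I^*$ put the metric $\bar\rho(x,y)=d_H(\pi^{-1}(x),\pi^{-1}(y))$, where $\pi^{-1}(x)=\Omega\times\{x\}$ and $d_H$ is the Hausdorff distance $$d_H\big(\pi^{-1}(x),\pi^{-1}(y)\big)=\inf\Big\{\epsilon>0:\pi^{-1}(y)\subset\bigcup_{\omega\in\Omega}B_\rho((\omega,x),\epsilon)\text{ and }\pi^{-1}(x)\subset\bigcup_{\omega\in\Omega}B_\rho((\omega,y),\epsilon)\Big\}.$$ **Counting function.** $\mathcal N_k(x,\beta)$ is the number of words $(a_1,\dots,a_k)\in\{0,\dots,\lfloor\beta\rfloor\}^k$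 for which there is $(a_{k+n})_{n\ge1}$ in $\{0,\dots,\lfloor\beta\rfloor\}^{\mathbb N}$ with $x=\sum_{m\ge1}a_m\beta^{-m}$. It is a known theorem of Feng and Sidorov that for Pisot $\beta$ there is a constant $\gamma$ with $\lim_{k\to\infty}\frac1k\log\mathcal N_k(x,\beta)=\gamma$ for Lebesgue-a.e. $x\in I$. **Local dimension.** $d(\mu,x)=\lim_{r\downarrow0}\frac{\log\mu(B(x,r))}{\log r}$ when the limit exists, with $B(x,r)$ the open ball in the given metric. *)

theory Defs
  imports "HOL-Probability.Probability" "HOL-Computational_Algebra.Polynomial"
begin

section \<open>Greedy expansions, generalised multinacci numbers and Pisot numbers\<close>

text \<open>Sequences are indexed from 0 throughout: the paper's \<open>\<omega>\<^sub>1, \<omega>\<^sub>2, \<dots>\<close> is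
  \<open>\<omega> 0, \<omega> 1, \<dots>\<close>, and likewise for digit sequences. The codes \<open>\<alpha>\<^sub>j\<close> keep the index
  \<open>j \<ge> 1\<close>.\<close>

definition max_digit :: "real \<Rightarrow> nat" where
  "max_digit \<beta> = nat \<lfloor>\<beta>\<rfloor>"

definition right_end :: "real \<Rightarrow> real" where
  "right_end \<beta> = real (max_digit \<beta>) / (\<beta> - 1)"

definition expansion_interval :: "real \<Rightarrow> real set" where
  "expansion_interval \<beta> = {0..right_end \<beta>}"

text \<open>On \<open>x \<ge> 0\<close>, \<open>\<lfloor>\<beta> x\<rfloor> = k\<close> says exactly that \<open>x\<close> lies in \<open>[k/\<beta>, (k+1)/\<beta>)\<close>.\<close>

definition greedy_digit :: "real \<Rightarrow> real \<Rightarrow> nat" where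
  "greedy_digit \<beta> x =
     (if x < real (max_digit \<beta>) / \<beta> then nat \<lfloor>\<beta> * x\<rfloor> else max_digit \<beta>)"

definition greedy_map :: "real \<Rightarrow> real \<Rightarrow> real" where
  "greedy_map \<beta> x = \<beta> * x - real (greedy_digit \<beta> x)"

definition greedy_digits :: "real \<Rightarrow> real \<Rightarrow> nat \<Rightarrow> nat" where
  "greedy_digits \<beta> x n = greedy_digit \<beta> ((greedy_map \<beta> ^^ n) x)"

definition generalised_multinacci :: "real \<Rightarrow> bool" where
  "generalised_multinacci \<beta> \<longleftrightarrow>
     \<beta> > 1 \<and>
     (\<exists>n\<ge>2. 1 = (\<Sum>j<n. real (greedy_digits \<beta> 1 j) / \<beta> ^ (j + 1)) \<and>
             (\<forall>j<n. greedy_digits \<beta> 1 j \<ge> 1))"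

text \<open>The complex number \<open>z\<close> is a root of the minimal polynomial of \<open>x\<close> over the rationals.\<close>

definition galois_conjugate :: "real \<Rightarrow> complex \<Rightarrow> bool" where
  "galois_conjugate x z \<longleftrightarrow>
     (\<exists>p :: rat poly. irreducible p \<and> lead_coeff p = 1 \<and>
        poly (map_poly of_rat p) x = 0 \<and> poly (map_poly of_rat p) z = 0)"

definition pisot_number :: "real \<Rightarrow> bool" where
  "pisot_number \<beta> \<longleftrightarrow>
     \<beta> > 1 \<and> algebraic_int \<beta> \<and>
     (\<forall>z. galois_conjugate \<beta> z \<and> z \<noteq> complex_of_real \<beta> \<longrightarrow> norm z < 1)"


section \<open>The random \<open>\<beta>\<close>-transformation\<close>

definition branch_map :: "real \<Rightarrow> nat \<Rightarrow> real \<Rightarrow> real" where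
  "branch_map \<beta> k x = \<beta> * x - real k"

definition equality_region :: "real \<Rightarrow> nat \<Rightarrow> real set" where
  "equality_region \<beta> k =
     (if k = 0 then {0..<1 / \<beta>}
      else if k = max_digit \<beta> then
        {real (max_digit \<beta>) / (\<beta> * (\<beta> - 1)) + (real (max_digit \<beta>) - 1) / \<beta> <.. right_end \<beta>}
      else
        {real (max_digit \<beta>) / (\<beta> * (\<beta> - 1)) + (real k - 1) / \<beta> <..< (real k + 1) / \<beta>})"

definition switch_region :: "real \<Rightarrow> nat \<Rightarrow> real set" where
  "switch_region \<beta> k =
     {real k / \<beta> .. real (max_digit \<beta>) / (\<beta> * (\<beta> - 1)) + (real k - 1) / \<beta>}"

text \<open>\<open>\<Omega> = {0,1}\<^sup>\<nat>\<close> is the type \<open>nat \<Rightarrow> bool\<close>. For non-integer \<open>\<beta>\<close> (in particular for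
  generalised multinacci \<open>\<beta>\<close>) the regions \<open>E\<^sub>k\<close> (\<open>0 \<le> k \<le> \<lfloor>\<beta>\<rfloor>\<close>) and \<open>S\<^sub>k\<close>
  (\<open>1 \<le> k \<le> \<lfloor>\<beta>\<rfloor>\<close>) partition the interval, so the descriptions below are unique and
  the last branch concerns only points outside the interval.\<close>

definition random_map :: "real \<Rightarrow> (nat \<Rightarrow> bool) \<times> real \<Rightarrow> (nat \<Rightarrow> bool) \<times> real" where
  "random_map \<beta> = (\<lambda>(\<omega>, x).
     if \<exists>k\<in>{0..max_digit \<beta>}. x \<in> equality_region \<beta> k then
       (\<omega>, branch_map \<beta> (THE k. k \<in> {0..max_digit \<beta>} \<and> x \<in> equality_region \<beta> k) x)
     else if \<exists>k\<in>{1..max_digit \<beta>}. x \<in> switch_region \<beta> k then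
       (\<lambda>i. \<omega> (Suc i),
        branch_map \<beta>
          ((THE k. k \<in> {1..max_digit \<beta>} \<and> x \<in> switch_region \<beta> k) - 1 + of_bool (\<omega> 0)) x)
     else (\<omega>, x))"


section \<open>The symmetric Bernoulli convolution\<close>

definition bernoulli_convolution :: "real \<Rightarrow> real measure" where
  "bernoulli_convolution \<beta> =
     distr (Pi\<^sub>M UNIV (\<lambda>_ :: nat. measure_pmf (pmf_of_set {0..max_digit \<beta>}))) borel
       (\<lambda>b. \<Sum>k. real (b k) / \<beta> ^ (k + 1))"


section \<open>Coding and metrics\<close>

definition partition_points :: "real \<Rightarrow> real set" where
  "partition_points \<beta> =
     {snd ((random_map \<beta> ^^ n) (\<omega>, 1)) | n \<omega>. True} \<union>
     {snd ((random_map \<beta> ^^ n) (\<omega>, right_end \<beta> - 1)) | n \<omega>. True} \<union>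
     {real k / \<beta> | k. k \<le> max_digit \<beta>} \<union>
     {real (max_digit \<beta>) / (\<beta> * (\<beta> - 1)) + real k / \<beta> | k. k \<le> max_digit \<beta>}"

definition num_cells :: "real \<Rightarrow> nat" where
  "num_cells \<beta> = card (partition_points \<beta>) - 1"

text \<open>The \<open>k\<close>-th cell for \<open>1 \<le> k \<le> L\<close>. This uses that the set of partition points is finite,
  which is the case for generalised multinacci \<open>\<beta>\<close>.\<close>

definition cell :: "real \<Rightarrow> nat \<Rightarrow> real set" where
  "cell \<beta> k =
     {sorted_list_of_set (partition_points \<beta>) ! (k - 1) <..<
      sorted_list_of_set (partition_points \<beta>) ! k}"

definition regular_points :: "real \<Rightarrow> ((nat \<Rightarrow> bool) \<times> real) set" where
  "regular_points \<beta> =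
     (UNIV \<times> expansion_interval \<beta>) -
     (\<Union>n. (random_map \<beta> ^^ n) -` (UNIV \<times> partition_points \<beta>))"

definition code :: "real \<Rightarrow> nat \<Rightarrow> (nat \<Rightarrow> bool) \<times> real \<Rightarrow> nat" where
  "code \<beta> j p =
     (if snd p = 0 then 1
      else if snd p = right_end \<beta> then num_cells \<beta>
      else (THE k. k \<in> {1..num_cells \<beta>} \<and> snd ((random_map \<beta> ^^ (j - 1)) p) \<in> cell \<beta> k))"

definition regular_interval :: "real \<Rightarrow> real set" where
  "regular_interval \<beta> =
     {x \<in> expansion_interval \<beta>. UNIV \<times> {x} \<subseteq> regular_points \<beta>} \<union> {0, right_end \<beta>}"

text \<open>Distinct points of \<open>\<Omega> \<times> I\<^sup>*\<close> are separated by some coordinate of \<open>\<omega>\<close> or some code, so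
  the minimum is attained.\<close>

definition code_dist ::
    "real \<Rightarrow> (nat \<Rightarrow> bool) \<times> real \<Rightarrow> (nat \<Rightarrow> bool) \<times> real \<Rightarrow> real" where
  "code_dist \<beta> p q =
     (if p = q then 0
      else 1 / \<beta> ^ (LEAST k. fst p k \<noteq> fst q k \<or> code \<beta> (k + 1) p \<noteq> code \<beta> (k + 1) q))"

definition open_ball :: "'a set \<Rightarrow> ('a \<Rightarrow> 'a \<Rightarrow> real) \<Rightarrow> 'a \<Rightarrow> real \<Rightarrow> 'a set" where
  "open_ball M d x r = {y \<in> M. d x y < r}"

definition fibre_dist :: "real \<Rightarrow> real \<Rightarrow> real \<Rightarrow> real" where
  "fibre_dist \<beta> x y =
     Inf {\<epsilon>. \<epsilon> > 0 \<and>
       UNIV \<times> {y} \<subseteq> (\<Union>\<omega>. open_ball (UNIV \<times> regular_interval \<beta>) (code_dist \<beta>) (\<omega>, x) \<epsilon>) \<and>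
       UNIV \<times> {x} \<subseteq> (\<Union>\<omega>. open_ball (UNIV \<times> regular_interval \<beta>) (code_dist \<beta>) (\<omega>, y) \<epsilon>)}"


section \<open>Counting function and local dimension\<close>

definition expansion_count :: "real \<Rightarrow> nat \<Rightarrow> real \<Rightarrow> nat" where
  "expansion_count \<beta> k x =
     card {w :: nat list. length w = k \<and>
       (\<exists>a :: nat \<Rightarrow> nat. (\<forall>m. a m \<le> max_digit \<beta>) \<and> map a [0..<k] = w \<and>
          (\<lambda>m. real (a m) / \<beta> ^ (m + 1)) sums x)}"

text \<open>The measure \<open>\<mu>\<close> has at \<open>x\<close> the (finite) local dimension \<open>l\<close> with respect to the metric
  \<open>d\<close> on \<open>M\<close>. Positivity of the balls is made explicit because \<open>ln 0 = 0\<close> and because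
  \<^const>\<open>measure\<close> is 0 on non-measurable sets: if some ball were null, the mathematical quotient
  would be infinite for all small \<open>r\<close>.\<close>

definition has_local_dimension ::
    "'a set \<Rightarrow> ('a \<Rightarrow> 'a \<Rightarrow> real) \<Rightarrow> 'a measure \<Rightarrow> 'a \<Rightarrow> real \<Rightarrow> bool" where
  "has_local_dimension M d \<mu> x l \<longleftrightarrow>
     x \<in> M \<and>
     (\<forall>r>0. measure \<mu> (open_ball M d x r) > 0) \<and>
     ((\<lambda>r. ln (measure \<mu> (open_ball M d x r)) / ln r) \<longlongrightarrow> l) (at_right 0)"

end

theory Submission
  imports Defs "HOL-Computational_Algebra.Computational_Algebra"
begin

text \<open>
  Write \<open>N\<^sub>n(x)\<close> for the number of words of length \<open>n\<close> that begin an expansion of \<open>x\<close>. For a regular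
  point \<open>x\<close> and \<open>\<beta>\<^bsup>-n-1\<^esup> < r \<le> \<beta>\<^bsup>-n\<^esup>\<close> the ball of radius \<open>r\<close> consists, up to a countable set, of the
  points whose first \<open>n + 1\<close> codes agree with those of \<open>x\<close> along every choice of digits, and these
  points form an interval. Self-similarity expresses the measure of this interval as the average of the
  measures of its images under the maps \<open>x \<mapsto> \<beta> x - d\<close> composed along all words of length \<open>n + 1\<close>. Only
  the words counted by \<open>N\<^bsub>n+1\<^esub>(x)\<close> contribute. By Garsia's lemma, which is the only place
  where the Pisot property enters, the partition is finite and the endpoints of the interval are at distance at least
  \<open>c \<beta>\<^bsup>-n\<^esup>\<close>, so each of these images contains an interval of length bounded below and hence has measure
  bounded below. Thus the measure of the ball is \<open>N\<^bsub>n+1\<^esub>(x) \<lceil>\<beta>\<rceil>\<^bsup>-n-1\<^esup>\<close> up to a constant factor.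
\<close>

section \<open>Garsia's finiteness lemma\<close>

text \<open>The fibre metric compares symbol sequences \<omega>, and a random orbit consumes a
  symbol only when it visits a switch region. Two orbits with equal digit sets and equal symbols
  nevertheless stay synchronised, so agreement of codes along all \<omega> can be restated through
  digit words alone (\<open>same_cells\<close>). The restated condition is a finite system of
  comparisons \<open>f < tail w y\<close> with increasing affine maps of \<open>y\<close>, which is
  why it cuts out an interval, irregular points included.

  On the indices: agreement of n+1 codes locates the tails of all words of length at most n. This
  fixes the digits admissible there, hence the words of length n+1. So words of length n+1 are
  counted, while the endpoints of the interval are preimages of partition points under words of
  length at most n; the maps of the counted words stretch the interval to at least a fixed size.

  Countable exceptional sets may be discarded because the measure has no atoms, which follows from
  self-similarity by a contraction argument for the supremum of the point masses.\<close>

abbreviation rat_eval :: "rat poly \<Rightarrow> 'a::field_char_0 \<Rightarrow> 'a" where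
  "rat_eval p x \<equiv> poly (map_poly of_rat p) x"

abbreviation int_eval :: "int poly \<Rightarrow> 'a::field_char_0 \<Rightarrow> 'a" where
  "int_eval p x \<equiv> poly (map_poly of_int p) x"

lemma rat_eval_pCons [simp]: "rat_eval (pCons a p) x = of_rat a + x * rat_eval p x"
  by (cases "a = 0 \<and> p = 0") (auto simp: map_poly_pCons)

lemma rat_eval_add: "rat_eval (p + q) x = rat_eval p x + rat_eval q x"
  by (induction p q rule: poly_induct2) (simp_all add: of_rat_add algebra_simps)

lemma rat_eval_smult: "rat_eval (smult c q) x = of_rat c * rat_eval q x"
  by (induction q) (simp_all add: of_rat_mult algebra_simps)

lemma rat_eval_mult: "rat_eval (p * q) x = rat_eval p x * rat_eval q x"
proof (induction p)
  case 0
  show ?case by simp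
next
  case (pCons a p)
  have "rat_eval (pCons a p * q) x = rat_eval (smult a q + pCons 0 (p * q)) x"
    by (simp only: mult_pCons_left)
  also have "\<dots> = rat_eval (pCons a p) x * rat_eval q x"
    using pCons by (simp add: rat_eval_add rat_eval_smult algebra_simps)
  finally show ?case .
qed

lemma int_eval_pCons [simp]: "int_eval (pCons a p) x = of_int a + x * int_eval p x"
  by (cases "a = 0 \<and> p = 0") (auto simp: map_poly_pCons)

lemma rat_eval_of_int: "rat_eval (map_poly of_int p) x = int_eval p x"
  by (induction p) (auto simp: map_poly_pCons)

lemma degree_of_rat: "degree (map_poly (of_rat :: rat \<Rightarrow> 'a::field_char_0) p) = degree p"
  by (rule degree_map_poly) simp

lemma norm_complex_of_rat: "norm (of_rat r :: complex) = real_of_rat \<bar>r\<bar>"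
proof (cases r)
  case (Fract k l)
  then have "(of_rat r :: complex) = complex_of_real (real_of_rat r)"
    by (simp add: of_rat_rat)
  then show ?thesis by simp
qed

section \<open>Minimal polynomials and their complex roots\<close>

lemma pderiv_of_rat:
  "pderiv (map_poly (of_rat :: rat \<Rightarrow> 'a::field_char_0) p) = map_poly of_rat (pderiv p)"
  by (rule poly_eqI) (simp add: coeff_pderiv coeff_map_poly of_rat_mult of_rat_add)

text \<open>A nonzero rational polynomial of least degree vanishing at \<open>b\<close>, made monic,
  is irreducible: in a factorisation one factor vanishes at \<open>b\<close>, so minimality gives it
  the full degree and leaves a constant cofactor.\<close>

lemma minimal_polynomial_exists:
  fixes b :: real
  assumes "algebraic_int b"
  obtains p :: "rat poly" where "irreducible p" "lead_coeff p = 1" "rat_eval p b = 0"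
proof -
  let ?P = "\<lambda>p :: rat poly. p \<noteq> 0 \<and> rat_eval p b = 0"
  obtain P :: "int poly" where P: "int_eval P b = 0" "lead_coeff P = 1"
    using assms unfolding algebraic_int_altdef_ipoly by blast
  have "?P (map_poly of_int P)"
    using P by (auto simp: rat_eval_of_int map_poly_eq_0_iff)
  then obtain q where q: "?P q" and least: "\<And>q'. ?P q' \<Longrightarrow> degree q \<le> degree q'"
    using ex_has_least_nat[of ?P _ degree] by blast
  define p where "p = smult (inverse (lead_coeff q)) q"
  have p: "?P p" "lead_coeff p = 1" "degree p = degree q"
    using q unfolding p_def by (auto simp: rat_eval_smult)
  have "irreducible p"
  proof (rule irreducibleI)
    show "p \<noteq> 0" using p by simp

    show "\<not> is_unit p"
    proof
      assume "is_unit p"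
      then obtain c where "p = [:c:]" "c \<noteq> 0"
        using \<open>p \<noteq> 0\<close> by (auto simp: is_unit_poly_iff)
      with p show False by simp
    qed
    fix r s assume rs: "p = r * s"
    then have nz: "r \<noteq> 0" "s \<noteq> 0" using p by auto
    have deg: "degree r + degree s = degree q"
      using nz rs p by (simp add: degree_mult_eq)
    have "rat_eval r b = 0 \<or> rat_eval s b = 0"
      using p(1) rs by (simp add: rat_eval_mult)
    then have "degree s = 0 \<or> degree r = 0"
      using least[of r] least[of s] nz deg by auto
    then show "is_unit r \<or> is_unit s"
      using nz by (auto simp: is_unit_iff_degree)
  qed
  then show ?thesis using that p by blast
qed

lemma rat_eval_mod:
  assumes "rat_eval p x = 0"
  shows "rat_eval (q mod p) x = rat_eval q x"
proof -
  have "rat_eval q x = rat_eval (q div p * p + q mod p) x"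
    by (simp only: div_mult_mod_eq)
  also have "\<dots> = rat_eval (q mod p) x"
    unfolding rat_eval_add rat_eval_mult using assms by simp
  finally show ?thesis by simp
qed

text \<open>A nonzero polynomial \<open>g\<close> of least degree vanishing at \<open>x\<close>
  divides both \<open>p\<close> and \<open>q\<close>. It is not a unit, so irreducibility makes
  \<open>p\<close> divide \<open>g\<close> in turn. The field of \<open>x\<close> is left open
  because the lemma is applied to the real \<open>b\<close> and to complex roots.\<close>

lemma irreducible_dvd_if_common_root:
  fixes p q :: "rat poly" and x :: "'a::field_char_0"
  assumes "irreducible p" "rat_eval p x = 0" "rat_eval q x = 0"
  shows "p dvd q"
proof -
  let ?P = "\<lambda>g :: rat poly. g \<noteq> 0 \<and> rat_eval g x = 0"
  have "?P p" using assms by auto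
  then obtain g where g: "?P g" and least: "\<And>h. ?P h \<Longrightarrow> degree g \<le> degree h"
    using ex_has_least_nat[of ?P _ degree] by blast
  have dvd: "g dvd h" if "rat_eval h x = 0" for h
  proof -
    have "rat_eval (h mod g) x = 0" using g that by (simp add: rat_eval_mod)
    then have "h mod g = 0"
      using least[of "h mod g"] degree_mod_less[of g h] g by fastforce
    then show ?thesis by auto
  qed
  have "\<not> is_unit g"
  proof
    assume "is_unit g"
    then obtain c where "g = [:c:]" by (auto simp: is_unit_poly_iff)
    with g show False by simp
  qed
  then have "p dvd g" using irreducibleD'[OF assms(1) dvd[OF assms(2)]] by blast
  then show ?thesis using dvd[OF assms(3)] dvd_trans by blast
qed

text \<open>Separability in characteristic zero: a multiple root would be shared with the
  derivative, and \<open>p\<close> would divide a nonzero polynomial of smaller degree. The roots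
  thus supply as many interpolation nodes as a remainder modulo \<open>p\<close> has
  coefficients.\<close>

lemma card_complex_roots_irreducible:
  fixes p :: "rat poly"
  assumes "irreducible p"
  shows "card {z :: complex. rat_eval p z = 0} = degree p"
proof -
  have "p \<noteq> 0" "degree p > 0"
    using assms by (auto simp: irreducible_def is_unit_iff_degree)
  have ndvd: "\<not> p dvd pderiv p"
    using \<open>degree p > 0\<close> not_dvd_pderiv[of p] by simp
  let ?q = "map_poly of_rat p :: complex poly"
  have "rsquarefree ?q"
    unfolding rsquarefree_roots
  proof (intro allI notI)
    fix z assume "poly ?q z = 0 \<and> poly (pderiv ?q) z = 0"
    then have "p dvd pderiv p"
      using irreducible_dvd_if_common_root[OF assms, of z "pderiv p"] by (auto simp only: pderiv_of_rat)
    then show False using ndvd by simp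
  qed
  then have "smult (lead_coeff ?q) (\<Prod>z | poly ?q z = 0. [:-z, 1:]) = ?q"
    by (rule complex_poly_decompose_rsquarefree)
  then have "degree ?q = degree (smult (lead_coeff ?q) (\<Prod>z | poly ?q z = 0. [:-z, 1:]))"
    by simp
  also have "\<dots> = degree (\<Prod>z | poly ?q z = 0. [:-z, 1:])"
    using \<open>p \<noteq> 0\<close> by (simp add: map_poly_eq_0_iff)
  also have "\<dots> = card {z. poly ?q z = 0}"
    by (subst degree_prod_eq_sum_degree) auto
  finally show ?thesis by (simp add: degree_of_rat)
qed

text \<open>Newton interpolation: after division by X - a the quotient takes the values (q(z) -
  q(a)) / (z - a) at the remaining nodes, and these are bounded because the nodes are distinct. The
  disjunct \<open>q = 0\<close> covers the empty node set, where no degree is small enough.\<close>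

lemma coeffs_bounded_by_values:
  fixes Z :: "complex set"
  assumes "finite Z"
  shows "\<exists>C. \<forall>q. (q = 0 \<or> degree q < card Z) \<and> (\<forall>z\<in>Z. norm (poly q z) \<le> B)
           \<longrightarrow> (\<forall>i. norm (coeff q i) \<le> C)"
  using assms
proof (induction Z arbitrary: B rule: finite_induct)
  case empty
  show ?case by (rule exI[of _ 0]) auto
next
  case (insert a Z)
  \<comment> \<open>Inserting 1 keeps the minimum defined and positive when no other node is
    left.\<close>
  define d where "d = Min (insert 1 ((\<lambda>z. norm (z - a)) ` Z))"
  have d: "d > 0" "\<And>z. z \<in> Z \<Longrightarrow> d \<le> norm (z - a)"
    using insert.hyps unfolding d_def by (auto simp: Min_gr_iff)
  define B' where "B' = (B + B) / d"
  obtain C where C: "\<And>q i. (q = 0 \<or> degree q < card Z) \<Longrightarrow> (\<forall>z\<in>Z. norm (poly q z) \<le> B')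
      \<Longrightarrow> norm (coeff q i) \<le> C"
    using insert.IH[of B'] by blast
  show ?case
  proof (intro exI[of _ "B + C + norm a * C"] allI impI)
    fix q :: "complex poly" and i
    assume q: "(q = 0 \<or> degree q < card (insert a Z)) \<and> (\<forall>z\<in>insert a Z. norm (poly q z) \<le> B)"
    define s where "s = synthetic_div q a"
    have qs: "[:-a, 1:] * s + [:poly q a:] = q"
      unfolding s_def by (rule synthetic_div_correct')
    have "s = 0 \<or> degree s < card Z"
      using q insert.hyps unfolding s_def
      by (auto simp: degree_synthetic_div synthetic_div_eq_0_iff)
    moreover have "\<forall>z\<in>Z. norm (poly s z) \<le> B'"
    proof
      fix z assume z: "z \<in> Z"
      have "poly q z = (z - a) * poly s z + poly q a"
        by (subst qs[symmetric]) (simp add: algebra_simps)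
      then have "norm (z - a) * norm (poly s z) = norm (poly q z - poly q a)"
        by (simp add: norm_mult)
      also have "\<dots> \<le> B + B"
        using q z by (intro norm_triangle_le_diff add_mono) auto
      finally have "norm (z - a) * norm (poly s z) \<le> B + B" .
      moreover have "d * norm (poly s z) \<le> norm (z - a) * norm (poly s z)"
        using d z by (intro mult_right_mono) auto
      ultimately show "norm (poly s z) \<le> B'"
        using d(1) unfolding B'_def by (simp add: field_simps)
    qed
    ultimately have s: "norm (coeff s i) \<le> C" for i using C by blast
    have "C \<ge> 0" using s[of 0] norm_ge_zero order_trans by blast
    have "B \<ge> 0" using q norm_ge_zero order_trans by blast
    have "norm (coeff q i) \<le> B + C + norm a * C"
    proof (cases i)
      case 0
      have "coeff q 0 = poly q a - a * coeff s 0"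
        by (subst qs[symmetric]) simp
      also have "norm \<dots> \<le> B + norm a * C"
        using q s[of 0] by (intro norm_triangle_le_diff add_mono) (auto simp: norm_mult mult_left_mono)
      finally show ?thesis using 0 \<open>C \<ge> 0\<close> by simp
    next
      case (Suc k)
      have "coeff q i = coeff s k - a * coeff s i"
        by (subst qs[symmetric]) (simp add: Suc)
      also have "norm \<dots> \<le> C + norm a * C"
        using s[of k] s[of i] by (intro norm_triangle_le_diff add_mono) (auto simp: norm_mult mult_left_mono)
      finally show ?thesis using \<open>B \<ge> 0\<close> by simp
    qed
    then show "norm (coeff q i) \<le> B + C + norm a * C" .
  qed
qed

section \<open>Denominators of polynomial remainders\<close>

lemma common_denominator:
  fixes p :: "rat poly"
  shows "\<exists>N::nat. N > 0 \<and> (\<forall>i. of_nat N * coeff p i \<in> \<int>)"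
proof (induction p)
  case 0
  show ?case by (intro exI[of _ 1]) auto
next
  case (pCons a p)
  then obtain N :: nat where N: "N > 0" "\<And>i. of_nat N * coeff p i \<in> \<int>" by blast
  obtain k l :: int where kl: "a = of_int k / of_int l" "l > 0"
    by (metis quotient_of_div quotient_of_denom_pos surj_pair)
  define M where "M = nat l * N"
  have "of_nat M * coeff (pCons a p) i \<in> \<int>" for i
  proof (cases i)
    case 0
    have "of_nat M * a = (of_int (int N * k) :: rat)"
      using kl unfolding M_def by (simp add: of_nat_nat)
    then show ?thesis using 0 by (metis Ints_of_int coeff_pCons_0)
  next
    case (Suc j)
    have "of_nat (nat l) * (of_nat N * coeff p j) \<in> \<int>"
      by (rule Ints_mult[OF Ints_of_nat N(2)])
    then have "of_nat M * coeff p j \<in> \<int>" by (simp only: M_def of_nat_mult mult.assoc)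
    then show ?thesis using Suc by simp
  qed
  moreover have "M > 0" using N kl by (simp add: M_def)
  ultimately show ?case by blast
qed

text \<open>The remainder depends linearly on \<open>r\<close>, so raising the degree bound by one
  brings in only the denominators of a single further remainder, that of X^D. For the minimal
  polynomial of an algebraic integer Gauss's lemma would give \<open>N = 1\<close>; any common
  denominator serves the finiteness argument.\<close>

lemma remainder_common_denominator:
  fixes p :: "rat poly"
  shows "\<exists>N::nat. N > 0 \<and> (\<forall>r::int poly. (\<forall>i\<ge>D. coeff r i = 0) \<longrightarrow>
           (\<forall>i. of_nat N * coeff (map_poly of_int r mod p) i \<in> \<int>))"
proof (induction D)
  case 0
  have "(\<forall>i\<ge>0. coeff r i = 0) \<Longrightarrow> r = 0" for r :: "int poly"
    by (rule poly_eqI) simp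
  then have "of_nat 1 * coeff (map_poly of_int r mod p) i \<in> \<int>"
    if "\<forall>i\<ge>0. coeff r i = 0" for r :: "int poly" and i
    using that by fastforce
  then show ?case by (metis less_one)
next
  case (Suc D)
  then obtain N :: nat where N: "N > 0" "\<And>r i. (\<forall>i\<ge>D. coeff (r::int poly) i = 0) \<Longrightarrow>
           of_nat N * coeff (map_poly of_int r mod p) i \<in> \<int>" by blast
  obtain N' :: nat where N': "N' > 0" "\<And>i. of_nat N' * coeff (monom 1 D mod p) i \<in> \<int>"
    using common_denominator by blast
  have "of_nat (N * N') * coeff (map_poly of_int r mod p) i \<in> \<int>"
    if r: "\<forall>i\<ge>Suc D. coeff r i = 0" for r :: "int poly" and i
  proof -
    define c where "c = coeff r D"
    define s where "s = r - monom c D"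
    have s: "\<forall>i\<ge>D. coeff s i = 0"
      using r unfolding s_def c_def by (auto simp: not_less_eq_eq Suc_le_eq)
    have "map_poly of_int r = map_poly rat_of_int s + smult (of_int c) (monom 1 D)"
      by (rule poly_eqI) (auto simp: s_def coeff_map_poly)
    then have "map_poly of_int r mod p = map_poly rat_of_int s mod p + smult (of_int c) (monom 1 D mod p)"
      by (simp add: poly_mod_add_left mod_smult_left)
    then have "of_nat (N * N') * coeff (map_poly of_int r mod p) i =
        of_nat N' * (of_nat N * coeff (map_poly of_int s mod p) i)
        + of_nat N * (of_int c * (of_nat N' * coeff (monom 1 D mod p) i))"
      by (simp add: algebra_simps)
    also have "\<dots> \<in> \<int>"
      by (rule Ints_add[OF Ints_mult[OF Ints_of_nat N(2)[OF s]]
            Ints_mult[OF Ints_of_nat Ints_mult[OF Ints_of_int N'(2)]]])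
    finally show ?thesis .
  qed
  moreover have "N * N' > 0" using N N' by simp
  ultimately show ?case by blast
qed

section \<open>Values of integer polynomials and their finiteness\<close>

lemma monic_int_remainder:
  fixes P Q :: "int poly"
  assumes "lead_coeff P = 1"
  obtains s r where "Q = P * s + r" "r = 0 \<or> degree r < degree P"
proof -
  \<comment> \<open>Pseudo-division scales by a power of the leading coefficient, so for a monic
    divisor it is division over the integers.\<close>
  obtain s r where sr: "pseudo_divmod Q P = (s, r)" by fastforce
  have "P \<noteq> 0" using assms by auto
  from pseudo_divmod[OF this sr] assms have "Q = P * s + r" "r = 0 \<or> degree r < degree P"
    by auto
  then show ?thesis using that by blast
qed

text \<open>The degree is unbounded on purpose: each set is closed under multiplication by
  \<open>b\<close>, so words of all lengths can be treated inside one set.\<close>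

definition int_poly_values :: "real \<Rightarrow> nat \<Rightarrow> real set" where
  "int_poly_values b M = {int_eval q b | q. \<forall>i. \<bar>coeff q i\<bar> \<le> int M}"

text \<open>Comparison with a geometric series; in Horner form the bound is the fixed point of t ->
  M + |z| t. It does not depend on the degree of \<open>q\<close>.\<close>

lemma norm_int_eval_le:
  fixes z :: complex
  assumes "norm z < 1" "\<forall>i. \<bar>coeff q i\<bar> \<le> int M"
  shows "norm (int_eval q z) \<le> real M / (1 - norm z)"
  using assms(2)
proof (induction q)
  case 0
  show ?case using assms(1) by simp
next
  case (pCons a q)
  have "\<bar>a\<bar> \<le> int M" using pCons.prems[rule_format, of 0] by simp
  then have a: "norm (of_int a :: complex) \<le> real M"
    by (metis norm_of_int of_int_abs of_int_le_iff of_int_of_nat_eq)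
  have "norm (int_eval q z) \<le> real M / (1 - norm z)"
    using pCons.prems by (intro pCons.IH) (metis coeff_pCons_Suc)
  then have "norm (int_eval (pCons a q) z) \<le> real M + norm z * (real M / (1 - norm z))"
    using a unfolding int_eval_pCons
    by (intro norm_triangle_le add_mono) (auto simp: norm_mult intro!: mult_left_mono simp del: times_divide_eq_right)
  also have "\<dots> = real M / (1 - norm z)"
    using assms(1) by (simp add: field_simps)
  finally show ?case .
qed

lemma finite_bounded_denominator_polys:
  "finite {t :: rat poly. (\<forall>i\<ge>d. coeff t i = 0) \<and> (\<forall>i. of_nat N * coeff t i \<in> \<int>) \<and>
      (\<forall>i. \<bar>coeff t i\<bar> \<le> C)}" (is "finite ?S") if "N > 0"
proof -
  define K where "K = \<lceil>of_nat N * C\<rceil>"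
  define A :: "rat set" where "A = (\<lambda>k. of_int k / of_nat N) ` {-K..K}"
  have "finite A" by (simp add: A_def)
  have "?S \<subseteq> Poly ` {xs. set xs \<subseteq> A \<and> length xs = d}"
  proof
    fix t assume t: "t \<in> ?S"
    have "coeff t i \<in> A" for i
    proof -
      obtain k where k: "of_nat N * coeff t i = of_int k" using t Ints_cases by blast
      have "\<bar>of_nat N * coeff t i\<bar> \<le> of_nat N * C"
        using t by (simp add: abs_mult mult_left_mono)
      then have "\<bar>rat_of_int k\<bar> \<le> of_nat N * C" by (simp add: k)
      then have "\<bar>k\<bar> \<le> K"
        unfolding K_def by (metis of_int_abs le_of_int_ceiling of_int_le_iff order_trans)
      moreover have "coeff t i = of_int k / of_nat N" using k that by (simp add: field_simps)
      ultimately show ?thesis unfolding A_def by (intro image_eqI[of _ _ k]) auto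
    qed
    moreover have "t = Poly (map (coeff t) [0..<d])"
      using t by (intro poly_eqI) (auto simp: nth_default_def)
    ultimately show "t \<in> Poly ` {xs. set xs \<subseteq> A \<and> length xs = d}"
      by (intro image_eqI[of _ _ "map (coeff t) [0..<d]"]) auto
  qed
  then show ?thesis
    using finite_lists_length_eq[OF \<open>finite A\<close>] finite_surj by blast
qed

text \<open>Reduction modulo the minimal polynomial changes neither the value at \<open>b\<close>
  nor those at the conjugates. The former is bounded by assumption, the latter by the Pisot
  property, so interpolation at all conjugates bounds the coefficients of the remainder. With
  bounded denominators only finitely many remainders are left.\<close>

lemma garsia_finite:
  assumes "pisot_number b"
  shows "finite (int_poly_values b M \<inter> {-B..B})"
proof -
  have alg: "algebraic_int b" using assms by (simp add: pisot_number_def)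
  obtain p :: "rat poly" where p: "irreducible p" "lead_coeff p = 1" "rat_eval p b = 0"
    using minimal_polynomial_exists[OF alg] .
  define Z where "Z = {z :: complex. rat_eval p z = 0}"
  have "p \<noteq> 0" using p by auto
  have cZ: "card Z = degree p" unfolding Z_def using p(1) by (rule card_complex_roots_irreducible)
  have "finite Z" unfolding Z_def using \<open>p \<noteq> 0\<close>
    by (intro poly_roots_finite) (simp add: map_poly_eq_0_iff)
  have small: "norm z < 1" if "z \<in> Z" "z \<noteq> complex_of_real b" for z
    using assms that p unfolding pisot_number_def galois_conjugate_def Z_def by blast
  \<comment> \<open>Dividing by a monic integer polynomial first leaves an integer remainder of
    bounded degree, which is what \<open>remainder_common_denominator\<close> asks for.\<close>
  obtain P :: "int poly" where P: "int_eval P b = 0" "lead_coeff P = 1"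
    using alg unfolding algebraic_int_altdef_ipoly by blast
  have ofr: "int_eval q (complex_of_real b) = complex_of_real (int_eval q b)" for q
    by (induction q) auto
  obtain N :: nat where N: "N > 0" "\<And>r i. (\<forall>i\<ge>degree P. coeff (r::int poly) i = 0) \<Longrightarrow>
           of_nat N * coeff (map_poly of_int r mod p) i \<in> \<int>"
    using remainder_common_denominator by metis
  \<comment> \<open>One crude bound for all roots: \<open>B\<close> accounts for the root
    \<open>b\<close>, and each summand for one other conjugate.\<close>
  define W where "W = B + (\<Sum>z\<in>Z - {complex_of_real b}. real M / (1 - norm z))"
  obtain C where C: "\<And>q i. (q = 0 \<or> degree q < card Z) \<Longrightarrow> (\<forall>z\<in>Z. norm (poly q z) \<le> W)
      \<Longrightarrow> norm (coeff q i) \<le> C"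
    using coeffs_bounded_by_values[OF \<open>finite Z\<close>] by metis
  \<comment> \<open>\<open>C\<close> is rounded up because the coefficients are compared with it
    among the rationals.\<close>
  define S where "S = {t :: rat poly. (\<forall>i\<ge>degree p. coeff t i = 0) \<and>
      (\<forall>i. of_nat N * coeff t i \<in> \<int>) \<and> (\<forall>i. \<bar>coeff t i\<bar> \<le> of_int \<lceil>C\<rceil>)}"
  have "finite S" unfolding S_def by (rule finite_bounded_denominator_polys) fact
  moreover have "int_poly_values b M \<inter> {-B..B} \<subseteq> (\<lambda>t. rat_eval t b) ` S"
  proof
    fix y assume y: "y \<in> int_poly_values b M \<inter> {-B..B}"
    then obtain q where q: "y = int_eval q b" "\<forall>i. \<bar>coeff q i\<bar> \<le> int M"
      by (auto simp: int_poly_values_def)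
    obtain s r where r: "q = P * s + r" "r = 0 \<or> degree r < degree P"
      using monic_int_remainder[OF P(2)] .
    define t where "t = map_poly of_int q mod p"
    have ev: "rat_eval t z = int_eval q z" if "rat_eval p z = 0" for z :: complex
      using rat_eval_mod[OF that] by (simp add: t_def rat_eval_of_int)
    have int_mult: "map_poly rat_of_int (P * s) = map_poly of_int P * map_poly of_int s"
      by (rule poly_eqI) (simp add: coeff_map_poly coeff_mult)
    have int_add: "map_poly rat_of_int (u + v) = map_poly of_int u + map_poly of_int v" for u v
      by (rule poly_eqI) (simp add: coeff_map_poly)
    have deg_t: "t = 0 \<or> degree t < degree p"
      unfolding t_def by (rule degree_mod_less) fact
    have "p dvd map_poly of_int P"
      using irreducible_dvd_if_common_root[OF p(1,3)] P(1) by (simp add: rat_eval_of_int)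
    then have "t = map_poly of_int r mod p"
      unfolding t_def r(1) int_add int_mult by (simp add: poly_mod_add_left)
    then have "of_nat N * coeff t i \<in> \<int>" for i
      using N(2)[of r i] r(2) by (metis coeff_eq_0 coeff_0 order_less_le_trans)
    moreover have "\<bar>coeff t i\<bar> \<le> of_int \<lceil>C\<rceil>" for i
    proof -
      have "norm (int_eval q z) \<le> W" if "z \<in> Z" for z
      proof (cases "z = complex_of_real b")
        case True
        have "0 \<le> (\<Sum>z\<in>Z - {complex_of_real b}. real M / (1 - norm z))"
          using small by (intro sum_nonneg divide_nonneg_pos) auto
        then show ?thesis using y q(1) True unfolding W_def True ofr norm_of_real by (auto simp: abs_le_iff)
      next
        case False
        have "norm (int_eval q z) \<le> real M / (1 - norm z)"
          using small[OF that False] q(2) by (rule norm_int_eval_le)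
        also have "\<dots> \<le> (\<Sum>z\<in>Z - {complex_of_real b}. real M / (1 - norm z))"
          using that False \<open>finite Z\<close> small
          by (intro member_le_sum divide_nonneg_pos) auto
        also have "\<dots> \<le> W" using y unfolding W_def by auto
        finally show ?thesis .
      qed
      then have "norm (coeff (map_poly of_rat t :: complex poly) i) \<le> C"
        using deg_t unfolding cZ[symmetric]
        by (intro C) (auto simp: degree_of_rat ev Z_def)
      then have "real_of_rat \<bar>coeff t i\<bar> \<le> C"
        by (simp add: coeff_map_poly norm_complex_of_rat)
      then have "real_of_rat \<bar>coeff t i\<bar> \<le> real_of_rat (of_int \<lceil>C\<rceil>)"
        using of_rat_of_int_eq le_of_int_ceiling[of C] by (metis order_trans)
      then show ?thesis by (simp only: of_rat_less_eq)
    qed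
    ultimately have "t \<in> S" using deg_t unfolding S_def by (auto simp: coeff_eq_0)
    moreover have "y = rat_eval t b" using rat_eval_mod[OF p(3)] q by (simp add: t_def rat_eval_of_int)
    ultimately show "y \<in> (\<lambda>t. rat_eval t b) ` S" by blast
  qed
  ultimately show ?thesis by (rule finite_surj)
qed

section \<open>Digit words and the random map\<close>

text \<open>Non-integrality gives \<open>m < b\<close>, hence \<open>R < 2\<close> as soon as
  \<open>m \<ge> 2\<close>; this is what limits every point to at most two admissible
  digits.\<close>

locale noninteger_pisot =
  fixes b :: real
  assumes pisot: "pisot_number b" and nonint: "b \<notin> \<int>"
begin

abbreviation m where "m \<equiv> max_digit b"
abbreviation R where "R \<equiv> right_end b"
abbreviation I where "I \<equiv> expansion_interval b"
abbreviation F where "F \<equiv> partition_points b"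

lemma gt_1: "b > 1"
  using pisot by (simp add: pisot_number_def)

lemma max_digit_less: "real m < b"
proof -
  have "real_of_int \<lfloor>b\<rfloor> \<noteq> b" using nonint by (metis Ints_of_int)
  then have "real_of_int \<lfloor>b\<rfloor> < b" using of_int_floor_le[of b] by linarith
  then show ?thesis using gt_1 by (simp add: max_digit_def)
qed

lemma less_Suc_max_digit: "b < real m + 1"
  using gt_1 by (simp add: max_digit_def)

lemma ceiling_eq: "\<lceil>b\<rceil> = int m + 1"
  using max_digit_less less_Suc_max_digit by (intro ceiling_unique) auto

lemma max_digit_pos: "m \<ge> 1"
  using gt_1 less_Suc_max_digit by linarith

lemma right_end_gt_1: "R > 1"
  using gt_1 less_Suc_max_digit by (simp add: right_end_def)

lemma mult_right_end: "b * R = R + real m"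
  using gt_1 by (simp add: right_end_def field_simps)

lemma right_end_less_2: "R < 2" if "m \<ge> 2"
  using gt_1 max_digit_less that by (simp add: right_end_def field_simps)

lemma right_end_div: "real m / (b * (b - 1)) = R / b"
  by (simp add: right_end_def mult.commute)

lemma mem_I: "x \<in> I \<longleftrightarrow> 0 \<le> x \<and> x \<le> R"
  by (simp add: expansion_interval_def)

text \<open>The possible first digits of an expansion of \<open>z\<close>. On the interval this
  replaces both kinds of region: the set is the singleton of \<open>k\<close> on the equality region
  of \<open>k\<close> and consists of \<open>k - 1\<close> and \<open>k\<close> on the switch region
  of \<open>k\<close>.\<close>

definition digits :: "real \<Rightarrow> nat set" where
  "digits z = {d. d \<le> m \<and> b * z - real d \<in> I}"

text \<open>The remainder of \<open>x\<close> after the digits of \<open>w\<close>, rescaled by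
  \<open>b ^ length w\<close>.\<close>

definition tail :: "nat list \<Rightarrow> real \<Rightarrow> real" where
  "tail w x = foldl (\<lambda>z d. b * z - real d) x w"

text \<open>It suffices to test the last tail, because an orbit that has left the interval never
  returns (\<open>tail_outside\<close>).\<close>

definition words :: "nat \<Rightarrow> real \<Rightarrow> nat list set" where
  "words n x = {w. length w = n \<and> set w \<subseteq> {..m} \<and> tail w x \<in> I}"

lemma tail_simps [simp]:
  "tail [] x = x" "tail (d # w) x = tail w (b * x - real d)"
  by (simp_all add: tail_def)

lemma tail_append: "tail (v @ w) x = tail w (tail v x)"
  by (simp add: tail_def)

lemma tail_affine: "tail w x = b ^ length w * x + tail w 0"
proof (induction w arbitrary: x)
  case (Cons d w)
  from Cons[of "b * x - real d"] Cons[of "- real d"] show ?case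
    by (simp add: algebra_simps)
qed simp

lemma tail_diff: "tail w x - tail w y = b ^ length w * (x - y)"
  by (subst (1 2) tail_affine) (simp add: algebra_simps)

lemma tail_less_iff: "tail w x < tail w y \<longleftrightarrow> x < y"
proof -
  have "0 < b ^ length w" using gt_1 by simp
  then show ?thesis using tail_diff[of w y x]
    by (metis diff_gt_0_iff_gt zero_less_mult_pos zero_less_mult_iff order_less_asym)
qed

text \<open>Words of equal length give affine maps of equal slope, so agreement at one point is
  agreement everywhere. Distinct words may well define the same map.\<close>

lemma tail_eq_transfer:
  assumes "tail v x = tail w x" "length v = length w"
  shows "tail v y = tail w y"
  using assms tail_affine[of v x] tail_affine[of v y] tail_affine[of w x] tail_affine[of w y]
  by (simp only:)

text \<open>The endpoints 0 and \<open>R\<close> are the repelling fixed points of the branches with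
  digits 0 and \<open>m\<close>, so points beyond them are pushed further out, whatever the
  digit.\<close>

lemma outside_I:
  assumes "z \<notin> I" "d \<le> m"
  shows "b * z - real d \<notin> I"
proof (cases "z < 0")
  case True
  then have "b * z < 0" using gt_1 by (simp add: mult_pos_neg)
  then show ?thesis by (simp add: mem_I)
next
  case False
  then have "R < z" using assms by (simp add: mem_I)
  then have "R + real m < b * z"
    using gt_1 mult_right_end by (metis mult_less_cancel_left_pos less_trans zero_less_one)
  then show ?thesis using assms by (simp add: mem_I)
qed

lemma tail_outside:
  assumes "z \<notin> I" "set w \<subseteq> {..m}"
  shows "tail w z \<notin> I"
  using assms by (induction w arbitrary: z) (auto simp: outside_I)

lemma digits_iff: "d \<in> digits z \<longleftrightarrow> d \<le> m \<and> real d \<le> b * z \<and> b * z \<le> real d + R"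
  by (auto simp: digits_def mem_I)

text \<open>The greedy digit is admissible.\<close>

lemma digits_nonempty:
  assumes "z \<in> I" shows "digits z \<noteq> {}"
proof (cases "b * z \<ge> real m")
  case True
  have "b * z \<le> b * R" using assms gt_1 by (simp add: mem_I)
  then have "m \<in> digits z" using True mult_right_end by (simp add: digits_iff)
  then show ?thesis by blast
next
  case False
  have "0 \<le> b * z" using assms gt_1 by (simp add: mem_I)
  have "nat \<lfloor>b * z\<rfloor> \<in> digits z"
    using False \<open>0 \<le> b * z\<close> right_end_gt_1 unfolding digits_iff by linarith
  then show ?thesis by blast
qed

lemma mem_equality_region:
  assumes "z \<in> I" "k \<le> m"
  shows "z \<in> equality_region b k \<longleftrightarrow> digits z = {k}"
proof -
  have bz: "0 \<le> b * z" "b * z \<le> R + real m"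
    using assms gt_1 mult_right_end by (auto simp: mem_I) (metis mult_le_cancel_left_pos less_trans zero_less_one)
  have "z \<in> equality_region b k \<longleftrightarrow>
      (k = 0 \<or> real k - 1 + R < b * z) \<and> (k = m \<or> b * z < real k + 1)"
    using assms gt_1 max_digit_pos unfolding equality_region_def right_end_div mem_I
    by (auto simp: field_simps)
  also have "\<dots> \<longleftrightarrow> digits z = {k}"
  proof
    assume a: "(k = 0 \<or> real k - 1 + R < b * z) \<and> (k = m \<or> b * z < real k + 1)"
    have "k \<in> digits z" using a bz assms right_end_gt_1 by (auto simp: digits_iff)
    moreover have "d = k" if "d \<in> digits z" for d
    proof (rule ccontr)
      assume "d \<noteq> k"
      then consider "real d \<le> real k - 1" | "real k + 1 \<le> real d" by linarith
      then show False using that a bz by cases (auto simp: digits_iff)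
    qed
    ultimately show "digits z = {k}" by blast
  next
    assume a: "digits z = {k}"
    then have k: "real k \<le> b * z" "b * z \<le> real k + R" using digits_iff[of k z] by auto
    have "real k - 1 + R < b * z" if "k \<noteq> 0"
    proof -
      have "k - 1 \<notin> digits z" using a that by auto
      then show ?thesis using k that assms by (auto simp: digits_iff of_nat_diff)
    qed
    moreover have "b * z < real k + 1" if "k \<noteq> m"
    proof -
      have "Suc k \<notin> digits z" using a by auto
      then show ?thesis using k that assms by (auto simp: digits_iff)
    qed
    ultimately show "(k = 0 \<or> real k - 1 + R < b * z) \<and> (k = m \<or> b * z < real k + 1)"
      by blast
  qed
  finally show ?thesis .
qed

text \<open>A third digit would differ by at least 2 from one of the given two, but admissible
  digits lie within a range of length \<open>R\<close>, and \<open>R < 2\<close> when three digits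
  are available.\<close>

lemma digits_switch:
  assumes "k \<in> digits z" "Suc k \<in> digits z"
  shows "digits z = {k, Suc k}"
proof -
  have "d = k \<or> d = Suc k" if d: "d \<in> digits z" for d
  proof (rule ccontr)
    assume "\<not> (d = k \<or> d = Suc k)"
    then consider "real d + 2 \<le> real (Suc k)" "m \<ge> 2" | "real k + 2 \<le> real d" "m \<ge> 2"
      using d assms by (cases "d < k") (auto simp: digits_iff)
    then show False using d assms right_end_less_2 by cases (auto simp: digits_iff)
  qed
  with assms show ?thesis by blast
qed

text \<open>Admissible digits are the integers of an interval, cut off at 0 and \<open>m\<close>;
  two of them therefore force two consecutive ones.\<close>

lemma digits_cases:
  assumes "z \<in> I"
  obtains (single) k where "digits z = {k}" "k \<le> m"
  | (switch) k where "digits z = {k, Suc k}" "Suc k \<le> m"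
proof -
  obtain k where k: "k \<in> digits z" using digits_nonempty[OF assms] by blast
  show ?thesis
  proof (cases "digits z = {k}")
    case True
    moreover have "k \<le> m" using k by (simp add: digits_iff)
    ultimately show ?thesis by (rule single)
  next
    case False
    then obtain d where d: "d \<in> digits z" "d \<noteq> k" using k by blast
    obtain i where i: "i \<in> digits z" "Suc i \<in> digits z"
    proof (cases "d < k")
      case True
      then have "Suc d \<in> digits z" using d(1) k unfolding digits_iff by auto
      then show ?thesis using that d(1) by blast
    next
      case False
      then have "Suc k \<in> digits z" using d k unfolding digits_iff by auto
      then show ?thesis using that k by blast
    qed
    then have "Suc i \<le> m" by (simp add: digits_iff)
    then show ?thesis using digits_switch[OF i] switch[of i] by blast
  qed
qed

lemma mem_switch_region:
  assumes "1 \<le> k" "k \<le> m"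
  shows "z \<in> switch_region b k \<longleftrightarrow> k - 1 \<in> digits z \<and> k \<in> digits z"
  using assms gt_1 right_end_gt_1 unfolding switch_region_def right_end_div digits_iff
  by (auto simp: field_simps of_nat_diff)

section \<open>Random orbits as digit words\<close>

lemma random_map_single:
  assumes "z \<in> I" "digits z = {k}"
  shows "random_map b (\<omega>, z) = (\<omega>, b * z - real k)"
proof -
  have k: "k \<le> m" using assms(2) digits_iff[of k z] by simp
  have the: "(THE j. j \<in> {0..m} \<and> z \<in> equality_region b j) = k"
  proof (rule the_equality)
    show "k \<in> {0..m} \<and> z \<in> equality_region b k"
      using mem_equality_region[OF assms(1) k] k assms(2) by simp
    show "j = k" if "j \<in> {0..m} \<and> z \<in> equality_region b j" for j
      using mem_equality_region[OF assms(1), of j] that assms(2) by simp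
  qed
  have "\<exists>j\<in>{0..m}. z \<in> equality_region b j"
    using mem_equality_region[OF assms(1) k] k assms(2) by auto
  then show ?thesis unfolding random_map_def by (simp only: prod.case if_True the branch_map_def)
qed

lemma random_map_switch:
  assumes "z \<in> I" "digits z = {k, Suc k}"
  shows "random_map b (\<omega>, z) = (\<lambda>i. \<omega> (Suc i), b * z - real (k + of_bool (\<omega> 0)))"
proof -
  have k: "Suc k \<le> m" using assms(2) digits_iff[of "Suc k" z] by simp
  have "\<not> (\<exists>j\<in>{0..m}. z \<in> equality_region b j)"
    using mem_equality_region[OF assms(1)] assms(2) by (auto simp: doubleton_eq_iff)
  moreover have sw: "j \<in> {1..m} \<and> z \<in> switch_region b j \<longleftrightarrow> j = Suc k" for j
  proof (cases "1 \<le> j \<and> j \<le> m")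
    case True
    then have "z \<in> switch_region b j \<longleftrightarrow> j - 1 \<in> {k, Suc k} \<and> j \<in> {k, Suc k}"
      using mem_switch_region[of j z] unfolding assms(2) by blast
    also have "\<dots> \<longleftrightarrow> j = Suc k" using True by fastforce
    finally show ?thesis using True by simp
  next
    case False
    then show ?thesis using k by fastforce
  qed
  moreover have "(THE j. j \<in> {1..m} \<and> z \<in> switch_region b j) = Suc k"
    unfolding sw by simp
  moreover have "\<exists>j\<in>{1..m}. z \<in> switch_region b j"
    using sw[of "Suc k"] by blast
  ultimately show ?thesis
    unfolding random_map_def by (simp only: prod.case if_True if_False branch_map_def diff_Suc_1)
qed

lemma Cons_in_words:
  "d # w \<in> words (Suc n) x \<longleftrightarrow> d \<in> digits x \<and> w \<in> words n (b * x - real d)"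
  using tail_outside[of "b * x - real d" w] by (auto simp: words_def digits_def)

lemma in_words_0 [simp]: "w \<in> words 0 x \<longleftrightarrow> w = [] \<and> x \<in> I"
  by (auto simp: words_def)

lemma finite_words: "finite (words n x)"
  by (rule finite_subset[OF _ finite_lists_length_eq[of "{..m}" n]]) (auto simp: words_def)

lemma digits_step: "d \<in> digits x \<Longrightarrow> b * x - real d \<in> I"
  by (simp add: digits_def)

abbreviation K where "K \<equiv> random_map b"

text \<open>Equal digit sets mean that both orbits meet switch regions at the same times, and equal
  symbols make them choose the same digit there. A step consumes at most one symbol, so n common
  symbols last for n steps.\<close>

lemma coupled_orbits:
  assumes "x \<in> I" "y \<in> I" "\<forall>k<n. \<omega> k = \<omega>' k"
    and "\<forall>i<n. digits (snd ((K ^^ i) (\<omega>, x))) = digits (snd ((K ^^ i) (\<omega>', y)))"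
  shows "\<exists>w. w \<in> words n x \<and> w \<in> words n y \<and>
    snd ((K ^^ n) (\<omega>, x)) = tail w x \<and> snd ((K ^^ n) (\<omega>', y)) = tail w y"
  using assms
proof (induction n arbitrary: \<omega> \<omega>' x y)
  case 0
  then show ?case by (intro exI[of _ "[]"]) auto
next
  case (Suc n)
  have eq: "digits x = digits y" using Suc.prems(4)[rule_format, of 0] by simp
  obtain d \<omega>1 \<omega>1' where d: "d \<in> digits x" "K (\<omega>, x) = (\<omega>1, b * x - real d)"
      "K (\<omega>', y) = (\<omega>1', b * y - real d)" "\<forall>k<n. \<omega>1 k = \<omega>1' k"
  proof (cases rule: digits_cases[OF \<open>x \<in> I\<close>, case_names single switch])
    case (single k)
    then show ?thesis
      using that[of k \<omega> \<omega>'] random_map_single Suc.prems eq by auto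
  next
    case (switch k)
    have "\<omega> 0 = \<omega>' 0" using Suc.prems(3) by auto
    then show ?thesis
      using that[of "k + of_bool (\<omega> 0)" "\<lambda>i. \<omega> (Suc i)" "\<lambda>i. \<omega>' (Suc i)"]
        random_map_switch[OF _ switch(1)] random_map_switch[of y k] switch Suc.prems eq
      by (auto simp: of_bool_def)
  qed
  have "\<exists>w. w \<in> words n (b * x - real d) \<and> w \<in> words n (b * y - real d) \<and>
      snd ((K ^^ n) (\<omega>1, b * x - real d)) = tail w (b * x - real d) \<and>
      snd ((K ^^ n) (\<omega>1', b * y - real d)) = tail w (b * y - real d)"
  proof (rule Suc.IH)
    show "\<forall>i<n. digits (snd ((K ^^ i) (\<omega>1, b * x - real d))) =
        digits (snd ((K ^^ i) (\<omega>1', b * y - real d)))"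
    proof (intro allI impI)
      fix i assume "i < n"
      then show "digits (snd ((K ^^ i) (\<omega>1, b * x - real d))) =
          digits (snd ((K ^^ i) (\<omega>1', b * y - real d)))"
        using Suc.prems(4)[rule_format, of "Suc i"] d by (simp add: funpow_Suc_right del: funpow.simps)
    qed
  qed (use d eq digits_step in auto)
  then obtain w where w: "w \<in> words n (b * x - real d)" "w \<in> words n (b * y - real d)"
      "snd ((K ^^ n) (\<omega>1, b * x - real d)) = tail w (b * x - real d)"
      "snd ((K ^^ n) (\<omega>1', b * y - real d)) = tail w (b * y - real d)"
    by blast
  show ?case
    using w d eq by (intro exI[of _ "d # w"]) (simp add: Cons_in_words funpow_Suc_right del: funpow.simps)
qed

lemma orbit_is_tail:
  assumes "x \<in> I"
  shows "\<exists>w\<in>words n x. snd ((K ^^ n) (\<omega>, x)) = tail w x"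
  using coupled_orbits[OF assms assms, of n \<omega> \<omega>] by blast

lemma tail_is_orbit:
  assumes "x \<in> I" "w \<in> words n x"
  shows "\<exists>\<omega>. snd ((K ^^ n) (\<omega>, x)) = tail w x"
  using assms
proof (induction n arbitrary: x w)
  case 0
  then show ?case by simp
next
  case (Suc n)
  then obtain d v where w: "w = d # v" by (cases w) (auto simp: words_def)
  with Suc.prems have d: "d \<in> digits x" "v \<in> words n (b * x - real d)"
    by (auto simp: Cons_in_words)
  then obtain \<omega> where \<omega>: "snd ((K ^^ n) (\<omega>, b * x - real d)) = tail v (b * x - real d)"
    using Suc.IH digits_step by blast
  have "\<exists>\<omega>'. K (\<omega>', x) = (\<omega>, b * x - real d)"
  proof (cases rule: digits_cases[OF \<open>x \<in> I\<close>, case_names single switch])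
    case (single k)
    then show ?thesis using random_map_single[OF \<open>x \<in> I\<close>] d by auto
  next
    case (switch k)
    \<comment> \<open>The symbol prepended at a switch selects the upper digit exactly when
      \<open>d\<close> is that digit; at other points nothing is consumed and \<omega> stays as it
      is.\<close>
    define \<omega>' where "\<omega>' = case_nat (d = Suc k) \<omega>"
    have "K (\<omega>', x) = (\<omega>, b * x - real d)"
      using random_map_switch[OF \<open>x \<in> I\<close> switch(1), of \<omega>'] d switch unfolding \<omega>'_def by auto
    then show ?thesis by blast
  qed
  then obtain \<omega>' where "K (\<omega>', x) = (\<omega>, b * x - real d)" by blast
  with \<omega> show ?case
    by (intro exI[of _ \<omega>']) (simp add: w funpow_Suc_right del: funpow.simps)
qed

lemma orbit_in_I: "x \<in> I \<Longrightarrow> snd ((K ^^ n) (\<omega>, x)) \<in> I"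
  using orbit_is_tail[of x n \<omega>] by (auto simp: words_def)

section \<open>Digit words as prefixes of expansions\<close>

lemma tail_map_upt:
  "tail (map a [0..<n]) x = b ^ n * (x - (\<Sum>j<n. real (a j) / b ^ (j + 1)))"
proof (induction n)
  case (Suc n)
  have "tail (map a [0..<Suc n]) x = b * tail (map a [0..<n]) x - real (a n)"
    by (simp add: tail_append)
  then show ?case unfolding Suc.IH using gt_1 by (simp add: algebra_simps)
qed simp

lemma digit_series_le:
  assumes "\<And>j. a j \<le> m"
  shows "summable (\<lambda>j. real (a j) / b ^ (j + 1))" "(\<Sum>j. real (a j) / b ^ (j + 1)) \<in> I"
proof -
  have g: "(\<lambda>j. real m / b ^ (j + 1)) sums R"
  proof -
    have "(\<lambda>j. real m / b * (1 / b) ^ j) sums (real m / b * (1 / (1 - 1 / b)))"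
      using gt_1 by (intro sums_mult geometric_sums) auto
    moreover have "real m / b * (1 / (1 - 1 / b)) = R"
      using gt_1 by (simp add: right_end_def field_simps)
    ultimately show ?thesis by (simp add: power_divide)
  qed
  have le: "real (a j) / b ^ (j + 1) \<le> real m / b ^ (j + 1)" for j
    using assms gt_1 by (intro divide_right_mono) auto
  have ge: "0 \<le> real (a j) / b ^ (j + 1)" for j
    using gt_1 by simp
  show s: "summable (\<lambda>j. real (a j) / b ^ (j + 1))"
  proof (rule summable_comparison_test'[OF sums_summable[OF g]])
    show "norm (real (a j) / b ^ (j + 1)) \<le> real m / b ^ (j + 1)" for j
      using ge[of j] le[of j] by (simp only: real_norm_def abs_of_nonneg)
  qed
  have "0 \<le> (\<Sum>j. real (a j) / b ^ (j + 1))" by (rule suminf_nonneg[OF s ge])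
  moreover have "(\<Sum>j. real (a j) / b ^ (j + 1)) \<le> R"
    using suminf_le[OF le s sums_summable[OF g]] sums_unique[OF g] by linarith
  ultimately show "(\<Sum>j. real (a j) / b ^ (j + 1)) \<in> I" by (simp add: mem_I)
qed

text \<open>If the series sums to \<open>x\<close>, each tail is again a digit series and so lies in
  the interval. Conversely, a tail in the interval bounds the error of the partial sum by
  \<open>R / b ^ n\<close>.\<close>

lemma digit_series_sums_iff:
  assumes "\<And>j. a j \<le> m"
  shows "(\<lambda>j. real (a j) / b ^ (j + 1)) sums x \<longleftrightarrow> (\<forall>n. tail (map a [0..<n]) x \<in> I)"
proof
  assume s: "(\<lambda>j. real (a j) / b ^ (j + 1)) sums x"
  show "\<forall>n. tail (map a [0..<n]) x \<in> I"
  proof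
    fix n
    have "x - (\<Sum>j<n. real (a j) / b ^ (j + 1)) = (\<Sum>j. real (a (j + n)) / b ^ (j + n + 1))"
      using suminf_minus_initial_segment[of "\<lambda>j. real (a j) / b ^ (j + 1)" n] s
      by (simp add: sums_iff)
    also have "\<dots> = (\<Sum>j. (1 / b ^ n) * (real (a (j + n)) / b ^ (j + 1)))"
      by (simp add: power_add mult_ac)
    also have "\<dots> = (1 / b ^ n) * (\<Sum>j. real (a (j + n)) / b ^ (j + 1))"
      using assms by (intro suminf_mult digit_series_le)
    finally have "tail (map a [0..<n]) x = (\<Sum>j. real (a (j + n)) / b ^ (j + 1))"
      using gt_1 by (simp add: tail_map_upt)
    then show "tail (map a [0..<n]) x \<in> I"
      using digit_series_le(2)[of "\<lambda>j. a (j + n)"] assms by simp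
  qed
next
  assume t: "\<forall>n. tail (map a [0..<n]) x \<in> I"
  have lim: "(\<lambda>n. R * (1 / b) ^ n) \<longlonglongrightarrow> 0"
    using gt_1 by (intro tendsto_mult_right_zero LIMSEQ_realpow_zero) auto
  have "(\<lambda>n. x - (\<Sum>j<n. real (a j) / b ^ (j + 1))) \<longlonglongrightarrow> 0"
  proof (rule Lim_null_comparison[OF _ lim])
    show "\<forall>\<^sub>F n in sequentially. norm (x - (\<Sum>j<n. real (a j) / b ^ (j + 1))) \<le> R * (1 / b) ^ n"
    proof (rule always_eventually, intro allI)
      fix n
      define e where "e = x - (\<Sum>j<n. real (a j) / b ^ (j + 1))"
      have "0 \<le> b ^ n * e" "b ^ n * e \<le> R"
        using t[rule_format, of n] unfolding tail_map_upt mem_I e_def by auto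
      moreover have "0 < b ^ n" using gt_1 by simp
      ultimately have "0 \<le> e" "e \<le> R * (1 / b) ^ n"
        using zero_le_mult_iff[of "b ^ n" e] by (auto simp: power_divide field_simps)
      then show "norm (x - (\<Sum>j<n. real (a j) / b ^ (j + 1))) \<le> R * (1 / b) ^ n"
        unfolding e_def[symmetric] by simp
    qed
  qed
  from tendsto_diff[OF tendsto_const[of x] this]
  show "(\<lambda>j. real (a j) / b ^ (j + 1)) sums x"
    unfolding sums_def by simp
qed

text \<open>A word whose tail lies in the interval extends to a full expansion, since an admissible
  next digit always exists.\<close>

lemma expansion_count_eq_card_words:
  assumes "x \<in> I"
  shows "expansion_count b n x = card (words n x)"
proof -
  have "(\<exists>a. (\<forall>j. a j \<le> m) \<and> map a [0..<n] = w \<and> (\<lambda>j. real (a j) / b ^ (j + 1)) sums x)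
      \<longleftrightarrow> w \<in> words n x" if w: "length w = n" for w
  proof
    assume "\<exists>a. (\<forall>j. a j \<le> m) \<and> map a [0..<n] = w \<and> (\<lambda>j. real (a j) / b ^ (j + 1)) sums x"
    then obtain a where a: "\<And>j. a j \<le> m" "w = map a [0..<n]"
        "(\<lambda>j. real (a j) / b ^ (j + 1)) sums x"
      by blast
    have "tail w x \<in> I" using a(3) unfolding digit_series_sums_iff[OF a(1)] a(2) by blast
    then show "w \<in> words n x" using a by (auto simp: words_def)
  next
    assume ww: "w \<in> words n x"
    define dig where "dig z = (SOME d. d \<in> digits z)" for z
    have dig: "dig z \<in> digits z" if "z \<in> I" for z
      unfolding dig_def some_in_eq using digits_nonempty[OF that] .
    \<comment> \<open>The orbit of the last tail under the chosen digits; \<open>a\<close> continues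
      \<open>w\<close> by reading them off.\<close>
    define z where "z = (\<lambda>k. ((\<lambda>z. b * z - real (dig z)) ^^ k) (tail w x))"
    have z_0: "z 0 = tail w x" and z_Suc: "z (Suc k) = b * z k - real (dig (z k))" for k
      by (simp_all add: z_def)
    have z: "z k \<in> I" for k
    proof (induction k)
      case 0
      show ?case using ww by (simp add: z_0 words_def)
    next
      case (Suc k)
      show ?case unfolding z_Suc by (rule digits_step[OF dig[OF Suc]])
    qed
    define a where "a j = (if j < n then w ! j else dig (z (j - n)))" for j
    have aw: "map a [0..<n] = w" using w by (intro nth_equalityI) (auto simp: a_def)
    have am: "a j \<le> m" for j
    proof (cases "j < n")
      case True
      then have "w ! j \<in> set w" using w by simp
      moreover have "set w \<subseteq> {..m}" using ww by (simp add: words_def)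
      ultimately show ?thesis using True unfolding a_def by auto
    next
      case False
      then show ?thesis using dig[OF z, of "j - n"] by (simp add: a_def digits_iff)
    qed
    have shift: "tail (map a [0..<n + k]) x = z k" for k
    proof (induction k)
      case 0
      then show ?case using aw by (simp add: z_0)
    next
      case (Suc k)
      have "tail (map a [0..<n + Suc k]) x = b * tail (map a [0..<n + k]) x - real (a (n + k))"
        by (simp add: tail_append)
      moreover have "a (n + k) = dig (z k)" by (simp add: a_def)
      ultimately show ?case unfolding Suc z_Suc by simp
    qed
    have "tail (map a [0..<i]) x \<in> I" for i
    proof (cases "n \<le> i")
      case True
      then show ?thesis using z[of "i - n"] shift[of "i - n"] by simp
    next
      case False
      then have split: "[0..<n] = [0..<i] @ [i..<n]" using upt_add_eq_append[of 0 i "n - i"] by simp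
      show ?thesis
      proof (rule ccontr)
        assume "tail (map a [0..<i]) x \<notin> I"
        moreover have "set (map a [i..<n]) \<subseteq> {..m}" using am by auto
        ultimately have "tail (map a [i..<n]) (tail (map a [0..<i]) x) \<notin> I"
          by (rule tail_outside)
        then have "tail w x \<notin> I"
          unfolding aw[symmetric] split map_append tail_append .
        then show False using ww unfolding words_def by blast
      qed
    qed
    then have "(\<lambda>j. real (a j) / b ^ (j + 1)) sums x"
      unfolding digit_series_sums_iff[OF am] by blast
    then show "\<exists>a. (\<forall>j. a j \<le> m) \<and> map a [0..<n] = w \<and> (\<lambda>j. real (a j) / b ^ (j + 1)) sums x"
      using am aw by blast
  qed
  moreover have "length w = n" if "w \<in> words n x" for w
    using that by (simp add: words_def)
  ultimately have "length w = n \<and> (\<exists>a. (\<forall>j. a j \<le> m) \<and> map a [0..<n] = w \<and>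
      (\<lambda>j. real (a j) / b ^ (j + 1)) sums x) \<longleftrightarrow> w \<in> words n x" for w
    by metis
  then have "{w. length w = n \<and> (\<exists>a. (\<forall>j. a j \<le> m) \<and> map a [0..<n] = w \<and>
      (\<lambda>j. real (a j) / b ^ (j + 1)) sums x)} = words n x"
    by simp
  then show ?thesis unfolding expansion_count_def by simp
qed

section \<open>Finiteness of the partition and separation of its preimages\<close>

abbreviation V where "V \<equiv> int_poly_values b"

section \<open>Closure properties of the sets of polynomial values\<close>

lemma V_I: "\<forall>i. \<bar>coeff q i\<bar> \<le> int M \<Longrightarrow> int_eval q b \<in> V M"
  by (auto simp: int_poly_values_def)

lemma V_mono: "y \<in> V M \<Longrightarrow> M \<le> M' \<Longrightarrow> y \<in> V M'"
proof -
  assume "y \<in> V M" "M \<le> M'"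
  then obtain q where q: "y = int_eval q b" "\<forall>i. \<bar>coeff q i\<bar> \<le> int M"
    by (auto simp: int_poly_values_def)
  have "\<forall>i. \<bar>coeff q i\<bar> \<le> int M'"
    using q(2) \<open>M \<le> M'\<close> by (meson of_nat_mono order_trans)
  then show "y \<in> V M'" unfolding q(1) by (rule V_I)
qed

text \<open>A Horner step adds a new constant coefficient and shifts the others, so the coefficient
  bound does not grow.\<close>

lemma V_affine:
  assumes "y \<in> V M" "\<bar>a\<bar> \<le> int M"
  shows "of_int a + b * y \<in> V M"
proof -
  obtain q where q: "y = int_eval q b" "\<forall>i. \<bar>coeff q i\<bar> \<le> int M"
    using assms(1) by (auto simp: int_poly_values_def)
  have "\<forall>i. \<bar>coeff (pCons a q) i\<bar> \<le> int M"
    using q(2) assms(2) by (auto simp: coeff_pCons split: nat.split)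
  from V_I[OF this] show ?thesis by (simp add: q(1))
qed

lemma V_int: "\<bar>a\<bar> \<le> int M \<Longrightarrow> of_int a \<in> V M"
  using V_I[of "[:a:]" M] by (auto simp: coeff_pCons split: nat.split)

lemma V_nat: "k \<le> M \<Longrightarrow> real k \<in> V M"
  using V_int[of "int k" M] by simp

lemma V_mult: "y \<in> V M \<Longrightarrow> b * y \<in> V M"
  using V_affine[of y M 0] by simp

lemma V_power: "y \<in> V M \<Longrightarrow> b ^ n * y \<in> V M"
  by (induction n) (simp_all add: V_mult mult.assoc)

lemma int_eval_diff: "int_eval (p - q) (x :: real) = int_eval p x - int_eval q x"
proof -
  have "map_poly real_of_int (p - q) = map_poly of_int p - map_poly of_int q"
    by (rule poly_eqI) (simp add: coeff_map_poly)
  then show ?thesis by simp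
qed

lemma V_diff:
  assumes "y \<in> V M" "y' \<in> V M'"
  shows "y - y' \<in> V (M + M')"
proof -
  obtain q q' where q: "y = int_eval q b" "\<forall>i. \<bar>coeff q i\<bar> \<le> int M"
    "y' = int_eval q' b" "\<forall>i. \<bar>coeff q' i\<bar> \<le> int M'"
    using assms by (auto simp: int_poly_values_def)
  have "\<bar>coeff (q - q') i\<bar> \<le> int (M + M')" for i
    using q(2)[rule_format, of i] q(4)[rule_format, of i] by simp
  with V_I[of "q - q'" "M + M'"] show ?thesis by (simp add: q int_eval_diff)
qed

lemma V_add:
  assumes "y \<in> V M" "y' \<in> V M'"
  shows "y + y' \<in> V (M + M')"
proof -
  have "0 - y' \<in> V (0 + M')" by (rule V_diff) (use V_nat[of 0 0] assms in auto)
  then have "y - (0 - y') \<in> V (M + M')" using assms V_diff[of y M "0 - y'" M'] by simp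
  then show ?thesis by simp
qed

lemma V_tail_0: "set w \<subseteq> {..m} \<Longrightarrow> tail w 0 \<in> V m"
proof (induction w rule: rev_induct)
  case Nil
  show ?case using V_nat[of 0] by simp
next
  case (snoc d w)
  then show ?case using V_affine[of "tail w 0" m "- int d"] by (simp add: tail_append)
qed

text \<open>Multiplication by \<open>b (b - 1)\<close> clears the denominators of all partition points.\<close>

definition den :: real where "den = b * (b - 1)"

lemma den_pos: "den > 0"
  using gt_1 by (simp add: den_def)

lemma den_mult_V:
  assumes "y \<in> V M" shows "den * y \<in> V (2 * M)"
proof -
  have "den * y = b * (b * y) - b * y" by (simp add: den_def algebra_simps)
  then show ?thesis
    using V_diff[OF V_mult[OF V_mult[OF assms]] V_mult[OF assms]] by (simp only: mult_2)
qed

lemma den_tail_V: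
  assumes "den * x \<in> V M" "set w \<subseteq> {..m}"
  shows "den * tail w x \<in> V (M + 2 * m)"
proof -
  have "den * tail w x = b ^ length w * (den * x) + den * tail w 0"
    by (subst tail_affine) (simp add: algebra_simps)
  then show ?thesis
    using V_add[OF V_power[OF assms(1)] den_mult_V[OF V_tail_0[OF assms(2)]]] by simp
qed

text \<open>The bound \<open>5 * m\<close> is uniform over all orbit lengths: for the two starting
  points \<open>den * x\<close> has bound \<open>m + 2\<close>, the digits of a word add
  \<open>2 * m\<close>, and \<open>3 * m + 2 \<le> 5 * m\<close> because \<open>m \<ge> 1\<close>.
  The explicit points need at most \<open>3 * m\<close>.\<close>

lemma partition_point:
  assumes "f \<in> F"
  shows "f \<in> I" "den * f \<in> V (5 * m)"
proof -
  have one: "1 \<in> I" "R - 1 \<in> I"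
    using right_end_gt_1 by (auto simp: mem_I)
  have d1: "den * 1 \<in> V (2 * 1)"
    by (rule den_mult_V) (use V_nat[of 1 1] in simp)
  have dR: "den * (R - 1) \<in> V (m + 2)"
  proof -
    have "den * (R - 1) = b * real m - den * 1"
      using gt_1 by (simp add: den_def right_end_def field_simps)
    then show ?thesis using V_diff[OF V_mult[OF V_nat[of m m]] d1] by simp
  qed
  have dk: "(b - 1) * real k \<in> V (2 * m)" if "k \<le> m" for k
    using V_diff[OF V_mult[OF V_nat[OF that]] V_nat[OF that]]
    by (simp only: mult_2 left_diff_distrib mult_1_left)
  have orbit: "f \<in> I \<and> den * f \<in> V (5 * m)"
    if fx: "f = snd ((K ^^ n) (\<omega>, x))" "x \<in> I" "den * x \<in> V (m + 2)" for n \<omega> x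
  proof -
    obtain w where w: "w \<in> words n x" "f = tail w x"
      using orbit_is_tail[OF fx(2), of n \<omega>] unfolding fx(1) by blast
    then have "den * f \<in> V (m + 2 + 2 * m)"
      using den_tail_V[OF fx(3), of w] by (simp add: words_def)
    then show ?thesis using w V_mono[of _ "m + 2 + 2 * m" "5 * m"] max_digit_pos
      by (auto simp: words_def)
  qed
  have ladder: "f \<in> I \<and> den * f \<in> V (5 * m)" if "f = real k / b" "k \<le> m" for k
  proof -
    have "real k \<le> R * b" using that(2) mult_right_end right_end_gt_1 by (simp add: mult.commute)
    then have "f \<le> R" using gt_1 unfolding that(1) by (simp add: pos_divide_le_eq)
    moreover have "den * f = (b - 1) * real k" using that gt_1 by (simp add: den_def)
    ultimately show ?thesis
      using that gt_1 V_mono[OF dk[OF that(2)], of "5 * m"] by (simp add: mem_I)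
  qed
  have ladder': "f \<in> I \<and> den * f \<in> V (5 * m)" if "f = R / b + real k / b" "k \<le> m" for k
  proof -
    have "R + real k \<le> R * b" using that(2) mult_right_end by (simp add: mult.commute)
    then have "f \<le> R"
      using gt_1 unfolding that(1) add_divide_distrib[symmetric] by (simp add: pos_divide_le_eq)
    moreover have "den * f = real m + (b - 1) * real k"
    proof -
      have "(b - 1) * R = real m" using gt_1 by (simp add: right_end_def)
      moreover have "den * f = (b - 1) * R + (b - 1) * real k"
        using gt_1 unfolding that(1) den_def by (simp add: field_simps)
      ultimately show ?thesis by simp
    qed
    moreover have "real m + (b - 1) * real k \<in> V (5 * m)"
      using V_mono[OF V_add[OF V_nat[of m m] dk[OF that(2)]], of "5 * m"] by simp
    ultimately show ?thesis
      using that gt_1 right_end_gt_1 by (simp add: mem_I)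
  qed
  have "den * 1 \<in> V (m + 2)" using V_mono[OF d1, of "m + 2"] by simp
  then have "f \<in> I \<and> den * f \<in> V (5 * m)"
    using assms orbit[OF _ one(1)] orbit[OF _ one(2) dR] ladder ladder'
    unfolding partition_points_def right_end_div by blast
  then show "f \<in> I" "den * f \<in> V (5 * m)" by auto
qed

lemma finite_partition_points: "finite F"
proof -
  have "F \<subseteq> (\<lambda>y. y / den) ` (V (5 * m) \<inter> {- (den * R)..den * R})"
  proof
    fix f assume f: "f \<in> F"
    have "den * f \<in> V (5 * m) \<inter> {- (den * R)..den * R}"
    proof -
      have "0 \<le> den * f" "den * f \<le> den * R" "0 \<le> den * R"
        using partition_point(1)[OF f] den_pos right_end_gt_1 by (auto simp: mem_I)
      then show ?thesis using partition_point(2)[OF f] by auto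
    qed
    then show "f \<in> (\<lambda>y. y / den) ` (V (5 * m) \<inter> {- (den * R)..den * R})"
      using den_pos by (intro image_eqI[of _ _ "den * f"]) auto
  qed
  then show ?thesis using garsia_finite[OF pisot] finite_surj by blast
qed

lemma partition_points_mem:
  "k \<le> m \<Longrightarrow> real k / b \<in> F" "k \<le> m \<Longrightarrow> R / b + real k / b \<in> F" "0 \<in> F" "R \<in> F"
proof -
  show 1: "real k / b \<in> F" if "k \<le> m" for k
    using that unfolding partition_points_def by blast
  show 2: "R / b + real k / b \<in> F" if "k \<le> m" for k
    using that unfolding partition_points_def right_end_div by blast
  show "0 \<in> F" using 1[of 0] by simp
  have "R / b + real m / b = R" using gt_1 mult_right_end by (simp add: field_simps)
  then show "R \<in> F" using 2[of m] by simp
qed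

text \<open>Finiteness on a bounded neighbourhood of 0 isolates 0.\<close>

lemma V_gap: "\<exists>c>0. \<forall>y\<in>V M. y \<noteq> 0 \<longrightarrow> c \<le> \<bar>y\<bar>"
proof -
  define A where "A = V M \<inter> {-1..1} - {0}"
  have fin: "finite (insert 1 (abs ` A))"
    using garsia_finite[OF pisot] by (simp add: A_def)
  define c where "c = Min (insert 1 (abs ` A))"
  have "c > 0" unfolding c_def using fin by (subst Min_gr_iff) (auto simp: A_def)
  moreover have "c \<le> \<bar>y\<bar>" if "y \<in> V M" "y \<noteq> 0" for y
  proof (cases "\<bar>y\<bar> \<le> 1")
    case True
    then have "\<bar>y\<bar> \<in> insert 1 (abs ` A)" using that by (auto simp: A_def abs_le_iff)
    then show ?thesis unfolding c_def using fin by (rule Min_le[rotated])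
  next
    case False
    have "c \<le> 1" unfolding c_def using fin by simp
    then show ?thesis using False by simp
  qed
  ultimately show ?thesis by blast
qed

text \<open>Scaled by \<open>den * b ^ n\<close>, every such preimage becomes an integer polynomial
  value with one fixed coefficient bound. Distinct preimages then differ by a nonzero value, to
  which the gap applies. Powers of \<open>b\<close> left over from words shorter than n do no
  harm.\<close>

lemma preimages_separated:
  obtains c where "c > 0"
    and "\<And>u v w w' n. \<lbrakk>tail w u \<in> F; tail w' v \<in> F; set w \<subseteq> {..m}; set w' \<subseteq> {..m};
      length w \<le> n; length w' \<le> n; u \<noteq> v\<rbrakk> \<Longrightarrow> c \<le> b ^ n * \<bar>u - v\<bar>"
proof -
  \<comment> \<open>Each scaled point has bound \<open>5 * m\<close> from the partition point plus
    \<open>2 * m\<close> from \<open>tail w 0\<close>; a difference adds two such bounds.\<close>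
  obtain c where c: "c > 0" "\<And>y. y \<in> V (7 * m + 7 * m) \<Longrightarrow> y \<noteq> 0 \<Longrightarrow> c \<le> \<bar>y\<bar>"
    using V_gap by metis
  have mem: "den * (b ^ n * u) \<in> V (7 * m)"
    if "tail w u \<in> F" "set w \<subseteq> {..m}" "length w \<le> n" for w u n
  proof -
    have "b ^ n = b ^ (n - length w) * b ^ length w"
      using that by (simp flip: power_add)
    then have "den * (b ^ n * u) = b ^ (n - length w) * (den * (b ^ length w * u))"
      by (simp add: mult_ac)
    also have "b ^ length w * u = tail w u - tail w 0"
      using tail_affine[of w u] by linarith
    finally have e: "den * (b ^ n * u) = b ^ (n - length w) * (den * tail w u - den * tail w 0)"
      by (simp add: right_diff_distrib)
    show ?thesis unfolding e
      using V_power[OF V_diff[OF partition_point(2)[OF that(1)] den_mult_V[OF V_tail_0[OF that(2)]]]]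
      by simp
  qed
  show ?thesis
  proof (rule that[of "c / den"])
    show "c / den > 0" using c den_pos by simp
    fix u v w w' n
    assume a: "tail w u \<in> F" "tail w' v \<in> F" "set w \<subseteq> {..m}" "set w' \<subseteq> {..m}"
      "length w \<le> n" "length w' \<le> n" "u \<noteq> v"
    have "den * (b ^ n * u) - den * (b ^ n * v) \<in> V (7 * m + 7 * m)"
      using a by (intro V_diff mem)
    moreover have e: "den * (b ^ n * u) - den * (b ^ n * v) = den * (b ^ n * (u - v))"
      by (simp add: algebra_simps)
    moreover have "den * (b ^ n * (u - v)) \<noteq> 0" using a den_pos gt_1 by simp
    ultimately have "c \<le> \<bar>den * (b ^ n * (u - v))\<bar>" using c(2) by metis
    also have "\<dots> = den * (b ^ n * \<bar>u - v\<bar>)" using den_pos gt_1 by (simp add: abs_mult)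
    finally show "c / den \<le> b ^ n * \<bar>u - v\<bar>" using den_pos by (simp add: field_simps)
  qed
qed

section \<open>Codes and the balls of the fibre metric\<close>

text \<open>Off the partition this is the number of the cell containing \<open>z\<close>: the least
  partition point is 0, so counting starts at 1. Unlike the code it is defined at every real, and it
  reduces equality of codes to order comparisons.\<close>

definition cell_index :: "real \<Rightarrow> nat" where
  "cell_index z = card {f \<in> F. f < z}"

text \<open>The sets of partition points below two reals are nested, so equal cardinality makes them
  equal.\<close>

lemma cell_index_eq_iff: "cell_index z = cell_index z' \<longleftrightarrow> (\<forall>f\<in>F. f < z \<longleftrightarrow> f < z')"
proof
  assume r: "cell_index z = cell_index z'"
  have "{f \<in> F. f < z} = {f \<in> F. f < z'}"
  proof (cases "z \<le> z'")
    case True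
    then show ?thesis using r finite_partition_points unfolding cell_index_def
      by (intro card_subset_eq) auto
  next
    case False
    then show ?thesis using r finite_partition_points unfolding cell_index_def
      by (intro card_subset_eq[symmetric]) auto
  qed
  then show "\<forall>f\<in>F. f < z \<longleftrightarrow> f < z'" by blast
next
  assume "\<forall>f\<in>F. f < z \<longleftrightarrow> f < z'"
  then have "{f \<in> F. f < z} = {f \<in> F. f < z'}" by blast
  then show "cell_index z = cell_index z'" by (simp add: cell_index_def)
qed

text \<open>Each digit is admissible on the closed interval from \<open>real d / b\<close> to
  \<open>R / b + real d / b\<close>, and both endpoints are partition points.\<close>

lemma digits_eq_of_cell_index:
  assumes "cell_index z = cell_index z'" "z \<notin> F" "z' \<notin> F"
  shows "digits z = digits z'"
proof -
  have "d \<in> digits y \<longleftrightarrow> d \<le> m \<and> real d / b < y \<and> \<not> R / b + real d / b < y"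
    if "y \<notin> F" for d y
  proof (cases "d \<le> m")
    case True
    then have "real d / b \<noteq> y" using that partition_points_mem(1)[of d] by auto
    then show ?thesis unfolding digits_iff using gt_1 True by (auto simp: field_simps)
  next
    case False
    then show ?thesis by (simp add: digits_iff)
  qed
  then show ?thesis
    using assms unfolding cell_index_eq_iff by (auto simp: partition_points_mem)
qed

lemma mem_cell_iff:
  assumes "z \<in> I" "z \<notin> F"
  shows "k \<in> {1..num_cells b} \<and> z \<in> cell b k \<longleftrightarrow> k = cell_index z"
proof -
  define xs where "xs = sorted_list_of_set F"
  have xs: "sorted xs" "distinct xs" "set xs = F"
    using finite_partition_points by (auto simp: xs_def)
  have len: "length xs = card F" by (simp add: xs_def)
  \<comment> \<open>In the sorted list the points below \<open>z\<close> form an initial segment, so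
    the zero-based entries at \<open>cell_index z - 1\<close> and \<open>cell_index z\<close>
    enclose \<open>z\<close>.\<close>
  have idx: "xs ! i < z \<longleftrightarrow> i < cell_index z" if "i < length xs" for i
  proof -
    have set_eq: "{f \<in> F. f < z} = set (filter (\<lambda>f. f < z) xs)" using xs by auto
    have rk: "cell_index z = length (filter (\<lambda>f. f < z) xs)"
      unfolding cell_index_def set_eq using xs by (intro distinct_card) auto
    have tw: "filter (\<lambda>f. f < z) xs = takeWhile (\<lambda>f. f < z) xs"
      using xs(1)
    proof (induction xs)
      case (Cons a xs)
      have "\<not> a < z \<Longrightarrow> filter (\<lambda>f. f < z) xs = []"
        using Cons.prems by (auto simp: filter_empty_conv)
      then show ?case using Cons by auto
    qed simp
    show ?thesis
    proof
      assume l: "xs ! i < z"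
      show "i < cell_index z"
      proof (rule ccontr)
        assume "\<not> i < cell_index z"
        then have r: "cell_index z \<le> i" by simp
        then have "cell_index z < length xs" using that by simp
        then have "\<not> xs ! cell_index z < z"
          unfolding rk tw by (rule nth_length_takeWhile)
        moreover have "xs ! cell_index z \<le> xs ! i" using xs(1) r that by (rule sorted_nth_mono)
        ultimately show False using l by simp
      qed
    next
      assume "i < cell_index z"
      then show "xs ! i < z"
        unfolding rk tw by (metis takeWhile_nth set_takeWhileD nth_mem)
    qed
  qed
  have ne: "xs ! i \<noteq> z" if "i < length xs" for i
    using assms that xs nth_mem by metis
  have bounds: "0 < z" "z < R"
    using assms partition_points_mem(3,4) unfolding mem_I by (metis less_eq_real_def)+
  have index_pos: "0 < cell_index z"
  proof -
    have "0 \<in> {f \<in> F. f < z}" using bounds partition_points_mem(3) by simp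
    then show ?thesis unfolding cell_index_def using finite_partition_points by (auto simp: card_gt_0_iff)
  qed
  have index_less: "cell_index z < card F"
  proof -
    have "R \<in> F - {f \<in> F. f < z}" using bounds(2) partition_points_mem(4) by simp
    then have "{f \<in> F. f < z} \<subset> F" by blast
    then show ?thesis
      unfolding cell_index_def by (rule psubset_card_mono[OF finite_partition_points])
  qed
  show ?thesis
  proof
    assume k: "k \<in> {1..num_cells b} \<and> z \<in> cell b k"
    then have "k < length xs" "xs ! (k - 1) < z" "z < xs ! k"
      using index_less unfolding num_cells_def cell_def xs_def[symmetric] len by auto
    then have "k - 1 < cell_index z" "\<not> k < cell_index z" using idx[of "k - 1"] idx[of k] by auto
    then show "k = cell_index z" using k by auto
  next
    assume k: "k = cell_index z"
    then have "xs ! (k - 1) < z" "z < xs ! k"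
      using idx[of "k - 1"] idx[of k] ne[of k] index_pos index_less len by auto
    then show "k \<in> {1..num_cells b} \<and> z \<in> cell b k"
      using k index_pos index_less unfolding num_cells_def cell_def xs_def[symmetric] by auto
  qed
qed

text \<open>The regular interval without its endpoints, described by words instead of by \<omega>.
  Both endpoints are partition points and so are excluded.\<close>

definition regular :: "real set" where
  "regular = {x \<in> I. \<forall>n. \<forall>w\<in>words n x. tail w x \<notin> F}"

lemma regular_orbit: "x \<in> regular \<Longrightarrow> snd ((K ^^ n) (\<omega>, x)) \<notin> F"
  using orbit_is_tail[of x n \<omega>] by (auto simp: regular_def)

lemma regular_interval_eq: "regular_interval b = regular \<union> {0, R}"
proof -
  have "UNIV \<times> {x} \<subseteq> regular_points b \<longleftrightarrow> x \<in> regular" if x: "x \<in> I" for x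
  proof
    assume a: "UNIV \<times> {x} \<subseteq> regular_points b"
    have "tail w x \<notin> F" if w: "w \<in> words n x" for n w
    proof -
      obtain \<omega> where \<omega>: "snd ((K ^^ n) (\<omega>, x)) = tail w x"
        using tail_is_orbit[OF x w] by blast
      have "(\<omega>, x) \<in> regular_points b" using a by blast
      then have "(K ^^ n) (\<omega>, x) \<notin> UNIV \<times> F" by (simp add: regular_points_def)
      then show ?thesis using \<omega> by (simp add: mem_Times_iff)
    qed
    then show "x \<in> regular" using x by (auto simp: regular_def)
  next
    assume reg: "x \<in> regular"
    have "(\<omega>, x) \<in> regular_points b" for \<omega>
      using regular_orbit[OF reg] x by (simp add: regular_points_def mem_Times_iff)
    then show "UNIV \<times> {x} \<subseteq> regular_points b" by blast
  qed
  moreover have "regular \<subseteq> I" by (auto simp: regular_def)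
  ultimately show ?thesis unfolding regular_interval_def by blast
qed

lemma regular_I: "x \<in> regular \<Longrightarrow> x \<in> I"
  by (simp add: regular_def)

lemma regular_not_F: "x \<in> regular \<Longrightarrow> x \<notin> F"
  using regular_orbit[of x 0] by simp

lemma code_eq_cell_index:
  assumes "x \<in> regular"
  shows "code b (k + 1) (\<omega>, x) = cell_index (snd ((K ^^ k) (\<omega>, x)))"
proof -
  have "x \<noteq> 0" "x \<noteq> R" using regular_not_F[OF assms] partition_points_mem by auto
  then have "code b (k + 1) (\<omega>, x) =
      (THE j. j \<in> {1..num_cells b} \<and> snd ((K ^^ k) (\<omega>, x)) \<in> cell b j)"
    by (simp add: code_def)
  also have "\<dots> = cell_index (snd ((K ^^ k) (\<omega>, x)))"
    unfolding mem_cell_iff[OF orbit_in_I[OF regular_I[OF assms]] regular_orbit[OF assms]] by simp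
  finally show ?thesis .
qed

text \<open>Only words of \<open>x\<close> are tested, and \<open>y\<close> may be any real. This
  asymmetry makes the set of all such \<open>y\<close> a genuine interval instead of an interval
  with countably many points removed.\<close>

definition same_cells :: "nat \<Rightarrow> real \<Rightarrow> real \<Rightarrow> bool" where
  "same_cells N x y \<longleftrightarrow>
     (\<forall>j<N. \<forall>w\<in>words j x. \<forall>f\<in>F. f < tail w x \<longleftrightarrow> f < tail w y)"

lemma orbits_coupled_by_indices:
  assumes "x \<in> regular" "y \<in> regular" "\<forall>k<n. \<omega> k = \<omega>' k"
    and "\<forall>i<n. cell_index (snd ((K ^^ i) (\<omega>, x))) = cell_index (snd ((K ^^ i) (\<omega>', y)))"
  shows "\<exists>w. w \<in> words n x \<and> w \<in> words n y \<and>
    snd ((K ^^ n) (\<omega>, x)) = tail w x \<and> snd ((K ^^ n) (\<omega>', y)) = tail w y"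
proof (rule coupled_orbits[OF assms(1,2)[THEN regular_I] assms(3)], intro allI impI)
  fix i assume "i < n"
  then show "digits (snd ((K ^^ i) (\<omega>, x))) = digits (snd ((K ^^ i) (\<omega>', y)))"
    using assms(4) regular_orbit[OF assms(1)] regular_orbit[OF assms(2)]
    by (intro digits_eq_of_cell_index) blast+
qed

text \<open>Agreement of the earlier indices produces a word shared by both orbits, and the
  comparison along this word gives the next index.\<close>

lemma same_cells_indices:
  assumes "x \<in> regular" "y \<in> regular" "same_cells N x y" "i < N"
  shows "cell_index (snd ((K ^^ i) (\<omega>, x))) = cell_index (snd ((K ^^ i) (\<omega>, y)))"
  using \<open>i < N\<close>
proof (induction i rule: less_induct)
  case (less i)
  have "\<forall>j<i. cell_index (snd ((K ^^ j) (\<omega>, x))) = cell_index (snd ((K ^^ j) (\<omega>, y)))"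
    using less.IH less.prems by simp
  then obtain w where w: "w \<in> words i x" "snd ((K ^^ i) (\<omega>, x)) = tail w x"
      "snd ((K ^^ i) (\<omega>, y)) = tail w y"
    using orbits_coupled_by_indices[OF assms(1,2), of i \<omega> \<omega>] by blast
  then show ?case
    using assms(3) less.prems unfolding cell_index_eq_iff same_cells_def w(2,3) by blast
qed

text \<open>Every word of \<open>x\<close> is realised by some \<omega>. The Hausdorff distance lets
  the partner \<omega>' depend on \<omega>, but agreement of the first \<open>N\<close> symbols
  suffices for coupling.\<close>

lemma indices_same_cells:
  assumes "x \<in> regular" "y \<in> regular"
    and "\<And>\<omega>. \<exists>\<omega>'. (\<forall>k<N. \<omega> k = \<omega>' k) \<and>
      (\<forall>i<N. cell_index (snd ((K ^^ i) (\<omega>, x))) = cell_index (snd ((K ^^ i) (\<omega>', y))))"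
  shows "same_cells N x y"
  unfolding same_cells_def
proof (intro allI impI ballI)
  fix j w f assume j: "j < N" and w: "w \<in> words j x" and f: "f \<in> F"
  obtain \<omega> where \<omega>: "snd ((K ^^ j) (\<omega>, x)) = tail w x"
    using tail_is_orbit[OF regular_I[OF assms(1)] w] by blast
  obtain \<omega>' where \<omega>': "\<forall>k<N. \<omega> k = \<omega>' k"
      "\<forall>i<N. cell_index (snd ((K ^^ i) (\<omega>, x))) = cell_index (snd ((K ^^ i) (\<omega>', y)))"
    using assms(3) by blast
  obtain v where v: "v \<in> words j x" "snd ((K ^^ j) (\<omega>, x)) = tail v x"
      "snd ((K ^^ j) (\<omega>', y)) = tail v y"
    using orbits_coupled_by_indices[OF assms(1,2), of j \<omega> \<omega>'] \<omega>' j by (meson less_trans)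
  have "tail v x = tail w x" using v(2) \<omega> by simp
  moreover have "length v = length w" using v(1) w by (simp add: words_def)
  ultimately have "tail v y = tail w y" by (rule tail_eq_transfer)
  moreover have "cell_index (snd ((K ^^ j) (\<omega>, x))) = cell_index (snd ((K ^^ j) (\<omega>', y)))"
    using \<omega>'(2) j by blast
  ultimately have "cell_index (tail w x) = cell_index (tail w y)" using v(3) \<omega> by simp
  then show "f < tail w x \<longleftrightarrow> f < tail w y" using f unfolding cell_index_eq_iff by blast
qed

text \<open>Permanent agreement would keep both orbits in the interval under the same expanding
  maps, so \<open>b ^ n * \<bar>x - y\<bar>\<close> would stay below \<open>R\<close>.\<close>

lemma indices_separate:
  assumes "x \<in> regular" "y \<in> regular" "x \<noteq> y"
  shows "\<exists>k. cell_index (snd ((K ^^ k) (\<omega>, x))) \<noteq> cell_index (snd ((K ^^ k) (\<omega>, y)))"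
proof (rule ccontr)
  assume "\<not> ?thesis"
  then have eq: "cell_index (snd ((K ^^ k) (\<omega>, x))) = cell_index (snd ((K ^^ k) (\<omega>, y)))" for k by blast
  have "b ^ n * \<bar>x - y\<bar> \<le> R" for n
  proof -
    obtain w where w: "w \<in> words n x" "w \<in> words n y"
      using orbits_coupled_by_indices[OF assms(1,2), of n \<omega> \<omega>] eq by blast
    then have "\<bar>tail w x - tail w y\<bar> \<le> R" by (auto simp: words_def mem_I)
    moreover have "length w = n" using w by (simp add: words_def)
    ultimately show ?thesis unfolding tail_diff using gt_1 by (simp add: abs_mult)
  qed
  moreover obtain n where "R / \<bar>x - y\<bar> < b ^ n" using real_arch_pow gt_1 by blast
  ultimately show False using assms(3) by (metis divide_less_eq not_le zero_less_abs_iff right_minus_eq)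
qed

section \<open>The code metric and the fibre metric\<close>

lemma code_dist_le_iff:
  assumes "x \<in> regular" "y \<in> regular"
  shows "code_dist b (\<omega>, x) (\<omega>', y) \<le> 1 / b ^ N \<longleftrightarrow>
    (\<forall>k<N. \<omega> k = \<omega>' k \<and> cell_index (snd ((K ^^ k) (\<omega>, x))) = cell_index (snd ((K ^^ k) (\<omega>', y))))"
proof (cases "(\<omega>, x) = (\<omega>', y)")
  case True
  then show ?thesis using gt_1 by (simp add: code_dist_def)
next
  case False
  let ?P = "\<lambda>k. \<omega> k \<noteq> \<omega>' k \<or> cell_index (snd ((K ^^ k) (\<omega>, x))) \<noteq> cell_index (snd ((K ^^ k) (\<omega>', y)))"
  \<comment> \<open>A witness is required for \<open>LEAST\<close> to be attained.\<close>
  have ex: "\<exists>k. ?P k"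
  proof (cases "\<omega> = \<omega>'")
    case True
    then show ?thesis using indices_separate[OF assms, of \<omega>] False by auto
  next
    case False
    then show ?thesis by auto
  qed
  have "code_dist b (\<omega>, x) (\<omega>', y) = 1 / b ^ (LEAST k. ?P k)"
    using False assms by (simp only: code_dist_def code_eq_cell_index if_False fst_conv)
  moreover have "1 / b ^ L \<le> 1 / b ^ N \<longleftrightarrow> N \<le> L" for L
    using gt_1 by (simp add: divide_simps power_increasing_iff)
  ultimately have "code_dist b (\<omega>, x) (\<omega>', y) \<le> 1 / b ^ N \<longleftrightarrow> N \<le> (LEAST k. ?P k)"
    by (simp only:)
  also have "\<dots> \<longleftrightarrow> (\<forall>k<N. \<not> ?P k)"
  proof
    assume "N \<le> (LEAST k. ?P k)"
    then show "\<forall>k<N. \<not> ?P k" using not_less_Least[of _ ?P] by (meson less_le_trans)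
  next
    assume "\<forall>k<N. \<not> ?P k"
    then show "N \<le> (LEAST k. ?P k)" using LeastI_ex[OF ex] by (meson not_le)
  qed
  finally show ?thesis by blast
qed

lemma code_dist_less_imp_le:
  assumes "code_dist b p q < 1 / b ^ N"
  shows "code_dist b p q \<le> 1 / b ^ Suc N"
proof (cases "p = q")
  case True
  then show ?thesis using gt_1 by (simp add: code_dist_def)
next
  case False
  then obtain k where k: "code_dist b p q = 1 / b ^ k" by (simp add: code_dist_def)
  have "N < k" using assms gt_1 unfolding k by (simp add: divide_simps)
  then have "b ^ Suc N \<le> b ^ k" using gt_1 by (intro power_increasing) auto
  then show ?thesis unfolding k using gt_1 by (intro divide_left_mono) auto
qed

definition fibre_radii :: "real \<Rightarrow> real \<Rightarrow> real set" where
  "fibre_radii x y = {\<epsilon>. \<epsilon> > 0 \<and>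
     (\<forall>\<omega>'. \<exists>\<omega>. code_dist b (\<omega>, x) (\<omega>', y) < \<epsilon>) \<and>
     (\<forall>\<omega>'. \<exists>\<omega>. code_dist b (\<omega>, y) (\<omega>', x) < \<epsilon>)}"

lemma fibre_dist_eq_Inf:
  assumes "x \<in> regular" "y \<in> regular"
  shows "fibre_dist b x y = Inf (fibre_radii x y)"
  unfolding fibre_dist_def fibre_radii_def open_ball_def regular_interval_eq using assms
  by (intro arg_cong[of _ _ Inf] Collect_cong) (auto simp: subset_iff)

lemma fibre_radii_if_same_cells:
  assumes x: "x \<in> regular" and y: "y \<in> regular" and "same_cells N x y" "1 / b ^ N < \<epsilon>"
  shows "\<epsilon> \<in> fibre_radii x y"
proof -
  have "code_dist b (\<omega>, x) (\<omega>, y) \<le> 1 / b ^ N" "code_dist b (\<omega>, y) (\<omega>, x) \<le> 1 / b ^ N" for \<omega>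
    using same_cells_indices[OF x y assms(3)] code_dist_le_iff x y by auto
  moreover have "0 < \<epsilon>"
    using assms(4) gt_1 by (meson less_trans zero_less_divide_1_iff zero_less_one zero_less_power)
  ultimately show ?thesis
    unfolding fibre_radii_def using assms(4) by (blast intro: le_less_trans)
qed

lemma fibre_dist_le:
  assumes "x \<in> regular" "y \<in> regular" "same_cells N x y" "1 / b ^ N < \<epsilon>"
  shows "fibre_dist b x y \<le> \<epsilon>"
proof -
  have "bdd_below (fibre_radii x y)"
    unfolding fibre_radii_def by (intro bdd_belowI[of _ 0]) auto
  then show ?thesis
    unfolding fibre_dist_eq_Inf[OF assms(1,2)]
    by (rule cInf_lower[OF fibre_radii_if_same_cells[OF assms]])
qed

text \<open>Code distances are 0 or powers of \<open>1 / b\<close>, so one below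
  \<open>1 / b ^ n\<close> is at most \<open>1 / b ^ Suc n\<close>: a radius in this range always
  means agreement of \<open>Suc n\<close> codes. In the converse direction the same \<omega> is used
  on both fibres.\<close>

lemma fibre_dist_less_iff:
  assumes x: "x \<in> regular" and y: "y \<in> regular"
    and r: "1 / b ^ Suc n < r" "r \<le> 1 / b ^ n"
  shows "fibre_dist b x y < r \<longleftrightarrow> same_cells (Suc n) x y"
proof
  assume "fibre_dist b x y < r"
  \<comment> \<open>The infimum needs a nonempty set; agreement of 0 codes is vacuous, so every
    radius above 1 belongs to it.\<close>
  moreover have "2 \<in> fibre_radii x y"
    using fibre_radii_if_same_cells[OF x y, of 0 2] by (simp add: same_cells_def)
  ultimately obtain \<epsilon> where \<epsilon>: "\<epsilon> \<in> fibre_radii x y" "\<epsilon> < r"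
    unfolding fibre_dist_eq_Inf[OF x y] using cInf_lessD[of "fibre_radii x y" r] by blast
  show "same_cells (Suc n) x y"
  proof (rule indices_same_cells[OF x y])
    fix \<omega>
    obtain \<omega>' where "code_dist b (\<omega>', y) (\<omega>, x) < \<epsilon>"
      using \<epsilon>(1) unfolding fibre_radii_def by blast
    then have "code_dist b (\<omega>', y) (\<omega>, x) \<le> 1 / b ^ Suc n"
      using \<epsilon>(2) r(2) by (intro code_dist_less_imp_le) linarith
    then show "\<exists>\<omega>'. (\<forall>k<Suc n. \<omega> k = \<omega>' k) \<and>
        (\<forall>i<Suc n. cell_index (snd ((K ^^ i) (\<omega>, x))) = cell_index (snd ((K ^^ i) (\<omega>', y))))"
      unfolding code_dist_le_iff[OF y x] by (intro exI[of _ \<omega>']) auto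
  qed
next
  assume same: "same_cells (Suc n) x y"
  obtain \<epsilon> where \<epsilon>: "1 / b ^ Suc n < \<epsilon>" "\<epsilon> < r" using dense r(1) by blast
  show "fibre_dist b x y < r" using fibre_dist_le[OF x y same \<epsilon>(1)] \<epsilon>(2) by simp
qed

section \<open>Self-similarity of the Bernoulli convolution\<close>

abbreviation mu where "mu \<equiv> bernoulli_convolution b"

abbreviation digit_measure :: "nat measure" where
  "digit_measure \<equiv> measure_pmf (pmf_of_set {0..m})"

abbreviation digit_seqs :: "(nat \<Rightarrow> nat) measure" where
  "digit_seqs \<equiv> Pi\<^sub>M UNIV (\<lambda>_. digit_measure)"

text \<open>Truncating the digits at \<open>m\<close> makes the series converge everywhere, not just almost surely.\<close>

definition digit_sum :: "(nat \<Rightarrow> nat) \<Rightarrow> real" where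
  "digit_sum a = (\<Sum>k. real (min (a k) m) / b ^ (k + 1))"

lemma digit_sum_mem: "digit_sum a \<in> I"
  unfolding digit_sum_def by (rule digit_series_le) simp

lemma digit_sum_case_nat:
  assumes "d \<le> m"
  shows "digit_sum (case_nat d a) = (real d + digit_sum a) / b"
proof -
  have s: "summable (\<lambda>k. real (min (a k) m) / b ^ (k + 1))" for a
    by (rule digit_series_le) simp
  have "digit_sum (case_nat d a) =
      (\<Sum>k. real (min (case_nat d a (Suc k)) m) / b ^ (Suc k + 1)) + real (min (case_nat d a 0) m) / b ^ (0 + 1)"
    unfolding digit_sum_def by (rule suminf_split_head[OF s, of "case_nat d a", THEN eq_diff_eq[THEN iffD1], symmetric])
  also have "(\<Sum>k. real (min (case_nat d a (Suc k)) m) / b ^ (Suc k + 1)) =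
      (\<Sum>k. real (min (a k) m) / b ^ (k + 1) / b)"
    by (simp add: mult_ac)
  also have "\<dots> = digit_sum a / b"
    unfolding digit_sum_def by (rule suminf_divide[OF s])
  finally show ?thesis using assms by (simp add: add_divide_distrib)
qed

lemma measurable_digit_sum [measurable]: "digit_sum \<in> borel_measurable digit_seqs"
proof -
  have "(\<lambda>a. real (min (a k) m)) \<in> borel_measurable digit_seqs" for k
  proof (rule measurable_compose[of "\<lambda>a. a k" _ digit_measure])
    show "(\<lambda>a. a k) \<in> measurable digit_seqs digit_measure"
      by (rule measurable_component_singleton) simp
  qed simp
  then show ?thesis unfolding digit_sum_def by measurable
qed

lemma mu_eq: "mu = distr digit_seqs borel digit_sum"
  unfolding bernoulli_convolution_def
proof (rule distr_cong_AE)
  have "AE a in digit_seqs. \<forall>k. a k \<le> m"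
    unfolding AE_all_countable
    by (intro allI AE_PiM_component) (auto simp: AE_measure_pmf_iff prob_space_measure_pmf)
  then show ae: "AE a in digit_seqs. (\<Sum>k. real (a k) / b ^ (k + 1)) = digit_sum a"
    by eventually_elim (simp add: digit_sum_def)
  have "(\<lambda>a. real (a k)) \<in> borel_measurable digit_seqs" for k
  proof (rule measurable_compose[of "\<lambda>a. a k" _ digit_measure])
    show "(\<lambda>a. a k) \<in> measurable digit_seqs digit_measure"
      by (rule measurable_component_singleton) simp
  qed simp
  then show "(\<lambda>a. \<Sum>k. real (a k) / b ^ (k + 1)) \<in> borel_measurable digit_seqs"
    by measurable
qed auto

sublocale digit_seqs: sequence_space digit_measure
  by unfold_locales

lemma prob_space_mu: "prob_space mu"
  unfolding mu_eq by (rule digit_seqs.prob_space_distr) measurable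

lemma sets_mu [simp]: "sets mu = sets borel"
  by (simp add: mu_eq)

sublocale mu: prob_space mu
  by (rule prob_space_mu)

lemma tail_vimage: "tail w ` A = (\<lambda>y. (y - tail w 0) / b ^ length w) -` A"
proof -
  have "y = tail w x \<longleftrightarrow> x = (y - tail w 0) / b ^ length w" for x y
    using gt_1 tail_affine[of w x] by (auto simp: field_simps)
  then have "(\<exists>x\<in>A. y = tail w x) \<longleftrightarrow> (y - tail w 0) / b ^ length w \<in> A" for y
    by metis
  then show ?thesis unfolding image_def vimage_def by simp
qed

lemma tail_image_borel [measurable]:
  assumes "A \<in> sets borel" shows "tail w ` A \<in> sets borel"
proof -
  have "(\<lambda>y. (y - tail w 0) / b ^ length w) \<in> borel_measurable borel" by simp
  from measurable_sets_borel[OF this assms] show ?thesis by (simp add: tail_vimage)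
qed

lemma mu_complement_I: "A \<inter> I = {} \<Longrightarrow> measure mu A = 0"
proof -
  assume A: "A \<inter> I = {}"
  have "measure mu A \<le> measure mu (- I)"
    using A by (intro mu.finite_measure_mono) (auto simp: expansion_interval_def)
  also have "\<dots> = measure digit_seqs (digit_sum -` (- I) \<inter> space digit_seqs)"
    unfolding mu_eq by (rule measure_distr) (auto simp: expansion_interval_def)
  also have "digit_sum -` (- I) \<inter> space digit_seqs = {}"
    using digit_sum_mem by auto
  finally show ?thesis by (simp add: measure_le_0_iff)
qed

lemma mu_I: "measure mu I = 1"
proof -
  have "measure mu (- I) = 0" by (rule mu_complement_I) auto
  moreover have "measure mu (space mu - I) = 1 - measure mu I"
    by (rule mu.prob_compl) (simp add: expansion_interval_def)
  moreover have "space mu = UNIV" by (simp add: mu_eq)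
  ultimately show ?thesis by (simp add: Compl_eq_Diff_UNIV)
qed

text \<open>Conditioning on the first digit: the digit sum has the law of (d + S) / b with
  \<open>d\<close> uniform and S an independent copy, and this lies in \<open>A\<close> exactly when
  S lies in the image of \<open>A\<close> under \<open>tail [d]\<close>.\<close>

lemma mu_self_similar:
  assumes A: "A \<in> sets borel"
  shows "measure mu A = (\<Sum>d\<le>m. measure mu (tail [d] ` A)) / (real m + 1)"
proof -
  let ?f = "\<lambda>(d, a). case_nat d a :: nat \<Rightarrow> nat"
  let ?D = "digit_measure \<Otimes>\<^sub>M digit_seqs"
  have f: "?f \<in> measurable ?D digit_seqs"
    by measurable
  define X where "X = (digit_sum \<circ> ?f) -` A \<inter> space ?D"
  have X: "X \<in> sets ?D"
    unfolding X_def by (rule measurable_sets[OF measurable_comp[OF f measurable_digit_sum] A])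
  have "emeasure mu A = emeasure (distr (distr ?D digit_seqs ?f) borel digit_sum) A"
    unfolding mu_eq digit_seqs.PiM_iter ..
  also have "\<dots> = emeasure (distr ?D borel (digit_sum \<circ> ?f)) A"
    by (subst distr_distr[OF measurable_digit_sum f]) simp
  also have "\<dots> = emeasure ?D X"
    unfolding X_def by (rule emeasure_distr[OF measurable_comp[OF f measurable_digit_sum] A])
  also have "\<dots> = (\<integral>\<^sup>+ d. emeasure digit_seqs (Pair d -` X) \<partial>digit_measure)"
    by (rule digit_seqs.emeasure_pair_measure_alt[OF X])
  also have "\<dots> = (\<Sum>d=0..m. emeasure digit_seqs (Pair d -` X)) / card {0..m}"
    by (rule nn_integral_pmf_of_set) auto
  also have "(\<Sum>d=0..m. emeasure digit_seqs (Pair d -` X)) = (\<Sum>d=0..m. emeasure mu (tail [d] ` A))"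
  proof (rule sum.cong[OF refl])
    fix d assume "d \<in> {0..m}"
    then have d: "d \<le> m" by simp
    have "Pair d -` X = digit_sum -` (tail [d] ` A) \<inter> space digit_seqs"
      unfolding X_def tail_vimage
      by (auto simp: space_pair_measure digit_sum_case_nat[OF d] add.commute)
    then show "emeasure digit_seqs (Pair d -` X) = emeasure mu (tail [d] ` A)"
      unfolding mu_eq using tail_image_borel[OF A, of "[d]"] by (simp only: emeasure_distr measurable_digit_sum)
  qed
  finally have "emeasure mu A = (\<Sum>d\<le>m. emeasure mu (tail [d] ` A)) / of_nat (m + 1)"
    by (simp add: atLeast0AtMost)
  also have "\<dots> = ennreal ((\<Sum>d\<le>m. measure mu (tail [d] ` A)) / (real m + 1))"
    by (simp add: mu.emeasure_eq_measure sum_ennreal divide_ennreal sum_nonneg ennreal_of_nat_eq_real_of_nat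
        del: of_nat_Suc of_nat_add)
  finally show ?thesis
    by (simp add: mu.emeasure_eq_measure sum_nonneg)
qed

section \<open>Iterated self-similarity and absence of atoms\<close>

definition all_words :: "nat \<Rightarrow> nat list set" where
  "all_words n = {w. length w = n \<and> set w \<subseteq> {..m}}"

lemma finite_all_words: "finite (all_words n)"
  using finite_lists_length_eq[of "{..m}" n] by (simp add: all_words_def conj_commute)

lemma card_all_words: "card (all_words n) = (m + 1) ^ n"
  using card_lists_length_eq[of "{..m}" n] by (simp add: all_words_def conj_commute)

lemma sum_all_words_Suc: "(\<Sum>w\<in>all_words (Suc n). g w) = (\<Sum>d\<le>m. \<Sum>w\<in>all_words n. g (d # w))"
proof -
  have "all_words (Suc n) = (\<lambda>(d, w). d # w) ` ({..m} \<times> all_words n)"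
    by (auto simp: all_words_def length_Suc_conv image_iff)
  moreover have "inj_on (\<lambda>(d, w). d # w) ({..m} \<times> all_words n)"
    by (auto simp: inj_on_def)
  ultimately have "(\<Sum>w\<in>all_words (Suc n). g w) = (\<Sum>(d, w)\<in>{..m} \<times> all_words n. g (d # w))"
    by (simp add: sum.reindex case_prod_unfold)
  also have "\<dots> = (\<Sum>d\<le>m. \<Sum>w\<in>all_words n. g (d # w))"
    by (rule sum.cartesian_product[symmetric])
  finally show ?thesis .
qed

lemma mu_self_similar_words:
  assumes "A \<in> sets borel"
  shows "measure mu A = (\<Sum>w\<in>all_words n. measure mu (tail w ` A)) / (real m + 1) ^ n"
  using assms
proof (induction n arbitrary: A)
  case 0
  have "all_words 0 = {[]}" by (auto simp: all_words_def)
  then show ?case by simp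
next
  case (Suc n)
  have "measure mu (tail [d] ` A) = (\<Sum>w\<in>all_words n. measure mu (tail (d # w) ` A)) / (real m + 1) ^ n" for d
    using Suc.IH[OF tail_image_borel[OF Suc.prems, of "[d]"]] by (simp add: image_image)
  then have "measure mu A =
      (\<Sum>d\<le>m. (\<Sum>w\<in>all_words n. measure mu (tail (d # w) ` A)) / (real m + 1) ^ n) / (real m + 1)"
    using mu_self_similar[OF Suc.prems] by simp
  also have "\<dots> = (\<Sum>w\<in>all_words (Suc n). measure mu (tail w ` A)) / (real m + 1) ^ Suc n"
    unfolding sum_all_words_Suc by (simp add: sum_divide_distrib[symmetric] mult.commute)
  finally show ?case .
qed

text \<open>Among all words of a suitable length at least one sends \<open>x\<close> out of the
  interval and contributes nothing, so each point mass is at most \<open>(1 - q) * s\<close> with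
  \<open>s\<close> the supremum of all point masses. Hence \<open>s = 0\<close>.\<close>

lemma mu_singleton: "measure mu {x} = 0"
proof -
  define s where "s = (SUP x. measure mu {x})"
  have bdd: "bdd_above (range (\<lambda>x. measure mu {x}))"
    by (intro bdd_aboveI[of _ 1]) auto
  have le_s: "measure mu {x} \<le> s" for x
    unfolding s_def by (rule cSUP_upper[OF _ bdd]) simp
  have "s \<ge> 0" using le_s[of 0] measure_nonneg order_trans by blast
  \<comment> \<open>The words of all zeros and of all \<open>m\<close> have tails differing by
    \<open>R * (b ^ k - 1)\<close>, which exceeds \<open>R\<close> once
    \<open>b ^ k > 2\<close>.\<close>
  obtain k where k: "2 < b ^ k" using real_arch_pow gt_1 by blast
  define q where "q = 1 / (real m + 1) ^ k"
  have q: "0 < q" by (simp add: q_def)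
  have "measure mu {x} \<le> (1 - q) * s" for x
  proof -
    define v where "v = replicate k (0::nat)"
    define w where "w = replicate k m"
    have vw: "v \<in> all_words k" "w \<in> all_words k" by (auto simp: v_def w_def all_words_def)
    have "tail (replicate j m) x = tail (replicate j 0) x - R * (b ^ j - 1)" for j
    proof (induction j arbitrary: x)
      case (Suc j)
      have "tail (replicate j m) (b * x - real m) = tail (replicate j m) (b * x) - b ^ j * real m"
        using tail_diff[of "replicate j m" "b * x - real m" "b * x"] by simp
      then have "tail (replicate (Suc j) m) x =
          tail (replicate j 0) (b * x) - R * (b ^ j - 1) - b ^ j * (b * R - R)"
        using Suc.IH[of "b * x"] mult_right_end by simp
      then show ?case by (simp add: algebra_simps)
    qed simp
    then have "tail w x = tail v x - R * (b ^ k - 1)" by (simp add: v_def w_def)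
    moreover have "R * 1 < R * (b ^ k - 1)" using k right_end_gt_1 by (intro mult_strict_left_mono) auto
    ultimately have "tail v x \<notin> I \<or> tail w x \<notin> I" by (auto simp: mem_I)
    then obtain u where u: "u \<in> all_words k" "tail u x \<notin> I" using vw by blast
    have "(\<Sum>w\<in>all_words k. measure mu (tail w ` {x})) =
        measure mu (tail u ` {x}) + (\<Sum>w\<in>all_words k - {u}. measure mu (tail w ` {x}))"
      by (rule sum.remove[OF finite_all_words u(1)])
    also have "measure mu (tail u ` {x}) = 0" using u by (intro mu_complement_I) auto
    also have "(\<Sum>w\<in>all_words k - {u}. measure mu (tail w ` {x})) \<le> of_nat (card (all_words k - {u})) * s"
      by (rule sum_bounded_above) (simp add: le_s)
    also have "card (all_words k - {u}) = (m + 1) ^ k - 1"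
      using u finite_all_words by (simp add: card_all_words)
    also have "real ((m + 1) ^ k - 1) = (real m + 1) ^ k - 1"
      by (simp add: of_nat_diff add.commute)
    finally have "measure mu {x} \<le> ((real m + 1) ^ k - 1) * s / (real m + 1) ^ k"
      using mu_self_similar_words[of "{x}" k] by (simp add: divide_right_mono)
    also have "\<dots> = (1 - q) * s" by (simp add: q_def field_simps)
    finally show ?thesis .
  qed
  then have "s \<le> (1 - q) * s" unfolding s_def[symmetric] by (subst s_def) (intro cSUP_least, auto)
  then have "q * s \<le> 0" by (simp add: algebra_simps)
  then have "s \<le> 0" using q by (simp add: mult_le_0_iff)
  then show ?thesis using le_s[of x] measure_nonneg[of mu "{x}"] by linarith
qed

lemma mu_countable:
  assumes "countable A" shows "measure mu A = 0"
proof -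
  have "A \<in> null_sets mu"
  proof -
    have "(\<Union>x\<in>A. {x}) \<in> null_sets mu"
      using assms by (intro null_sets_UN') (auto simp: null_sets_def mu.emeasure_eq_measure mu_singleton)
    then show ?thesis by simp
  qed
  then show ?thesis by (auto simp: null_sets_def measure_def)
qed

section \<open>Lower bounds for the mass of intervals\<close>

lemma words_nonempty:
  assumes "x \<in> I" shows "words n x \<noteq> {}"
  using orbit_is_tail[OF assms, of n] by blast

lemma mu_interval_ge:
  assumes "c > 0"
  shows "\<exists>c'>0. \<forall>u\<in>I. \<forall>v\<in>I. c \<le> v - u \<longrightarrow> c' \<le> measure mu {u<..<v}"
proof -
  \<comment> \<open>Half of an interval of length \<open>c\<close>, stretched by
    \<open>b ^ k\<close>, is longer than \<open>R\<close>. A word of length \<open>k\<close> keeping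
    the midpoint in the interval therefore maps it over all of the expansion interval.\<close>
  obtain k where k: "2 * R / c < b ^ k" using real_arch_pow gt_1 by blast
  have "1 / (real m + 1) ^ k \<le> measure mu {u<..<v}"
    if uv: "u \<in> I" "v \<in> I" "c \<le> v - u" for u v
  proof -
    define z where "z = (u + v) / 2"
    have "z \<in> I" using uv by (simp add: z_def mem_I)
    then obtain w where w: "w \<in> words k z" using words_nonempty by blast
    then have w': "w \<in> all_words k" "length w = k" "tail w z \<in> I"
      by (auto simp: words_def all_words_def)
    have "2 * R < c * b ^ k" using k assms by (simp add: field_simps)
    also have "\<dots> \<le> (v - u) * b ^ k" using uv gt_1 by (intro mult_right_mono) auto
    finally have big: "2 * R < (v - u) * b ^ k" .
    have "tail w z - tail w u = b ^ k * ((v - u) / 2)" "tail w v - tail w z = b ^ k * ((v - u) / 2)"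
      unfolding tail_diff w'(2) z_def by (simp_all add: field_simps)
    with big have "tail w u < 0" "R < tail w v"
      using w'(3) by (auto simp: mem_I field_simps)
    have "I \<subseteq> tail w ` {u<..<v}"
    proof
      fix y assume y: "y \<in> I"
      define x where "x = (y - tail w 0) / b ^ length w"
      have x: "tail w x = y" unfolding x_def using gt_1 by (subst tail_affine) simp
      then have "u < x" "x < v"
        using y \<open>tail w u < 0\<close> \<open>R < tail w v\<close> tail_less_iff[of w u x] tail_less_iff[of w x v]
        by (auto simp: mem_I)
      then show "y \<in> tail w ` {u<..<v}" using x by (intro image_eqI[of _ _ x]) auto
    qed
    then have "1 \<le> measure mu (tail w ` {u<..<v})"
      unfolding mu_I[symmetric] by (intro mu.finite_measure_mono) auto
    also have "\<dots> \<le> (\<Sum>w\<in>all_words k. measure mu (tail w ` {u<..<v}))"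
      by (rule member_le_sum[OF w'(1)]) (auto simp: finite_all_words)
    finally show ?thesis
      using mu_self_similar_words[of "{u<..<v}" k] by (simp add: divide_right_mono)
  qed
  then show ?thesis by (intro exI[of _ "1 / (real m + 1) ^ k"]) auto
qed

section \<open>The measure of balls and the local dimension\<close>

text \<open>An irregular point is determined by a word and the partition point at which its tail
  arrives.\<close>

lemma countable_irregular: "countable (I - regular)"
proof -
  let ?g = "\<lambda>w f. (f - tail w 0) / b ^ length w"
  have "x = ?g w (tail w x)" for w x
    using gt_1 tail_affine[of w x] by (simp add: field_simps)
  then have "I - regular \<subseteq> (\<Union>w. ?g w ` F)"
    unfolding regular_def by blast
  moreover have "countable (\<Union>w. ?g w ` F)"
    using finite_partition_points by (intro countable_UN) (auto intro: countable_finite)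
  ultimately show ?thesis by (rule countable_subset)
qed

lemma AE_regular: "AE x in lebesgue_on I. x \<in> regular"
proof (rule AE_I')
  have "I - regular \<in> null_sets lebesgue"
    using countable_imp_null_set_lborel[OF countable_irregular] by (rule null_sets_completionI)
  then show "I - regular \<in> null_sets (lebesgue_on I)"
    by (subst null_sets_restrict_space) (auto simp: expansion_interval_def)
  show "{x \<in> space (lebesgue_on I). x \<notin> regular} \<subseteq> I - regular" by auto
qed

section \<open>Intervals of points with the same codes\<close>

lemma snoc_in_words: "v @ [d] \<in> words (Suc j) x \<longleftrightarrow> v \<in> words j x \<and> d \<in> digits (tail v x)"
proof -
  have "tail (v @ [d]) x = b * tail v x - real d" by (simp add: tail_append)
  moreover have "d \<le> m \<Longrightarrow> b * tail v x - real d \<in> I \<Longrightarrow> tail v x \<in> I"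
    using outside_I by blast
  ultimately show ?thesis by (auto simp: words_def digits_def)
qed

lemma snoc_words_cases:
  assumes "w \<in> words (Suc j) x"
  obtains v d where "w = v @ [d]" "v \<in> words j x" "d \<in> digits (tail v x)"
proof -
  have "w \<noteq> []" using assms by (auto simp: words_def)
  then have "butlast w @ [last w] = w" by simp
  then show ?thesis using that[of "butlast w" "last w"] snoc_in_words[of "butlast w" "last w"] assms by metis
qed

lemma same_cells_in_I:
  assumes "x \<in> regular" "same_cells (Suc n) x y"
  shows "y \<in> I"
proof -
  have x: "0 < x" "x < R"
    using regular_I[OF assms(1)] regular_not_F[OF assms(1)] partition_points_mem(3,4)
    unfolding mem_I by (metis less_eq_real_def)+
  have "[] \<in> words 0 x" using regular_I[OF assms(1)] by simp
  then have "f < tail [] x \<longleftrightarrow> f < tail [] y" if "f \<in> F" for f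
    using assms(2) that unfolding same_cells_def by blast
  then have "f < x \<longleftrightarrow> f < y" if "f \<in> F" for f using that by simp
  from this[OF partition_points_mem(3)] this[OF partition_points_mem(4)] x
  show ?thesis by (auto simp: mem_I)
qed

text \<open>Strict comparisons at the regular \<open>x\<close> become at least weak ones at
  \<open>y\<close>, which is enough for admissibility. At an irregular \<open>y\<close> further
  digits may be admissible, so only an inclusion is claimed.\<close>

lemma same_cells_words_subset:
  assumes "x \<in> regular" "same_cells (Suc n) x y" "j \<le> Suc n"
  shows "words j x \<subseteq> words j y"
  using assms(3)
proof (induction j)
  case 0
  show ?case using same_cells_in_I[OF assms(1,2)] by auto
next
  case (Suc j)
  show ?case
  proof
    fix w assume "w \<in> words (Suc j) x"
    then obtain v d where w: "w = v @ [d]" "v \<in> words j x" "d \<in> digits (tail v x)"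
      by (rule snoc_words_cases)
    have d: "d \<le> m" "real d / b \<le> tail v x" "tail v x \<le> R / b + real d / b"
      using w(3) gt_1 by (auto simp: digits_iff field_simps)
    have F: "real d / b \<in> F" "R / b + real d / b \<in> F"
      using d(1) partition_points_mem(1,2) by auto
    have "tail v x \<notin> F" using w(2) assms(1) by (auto simp: regular_def)
    then have "real d / b < tail v x" "\<not> R / b + real d / b < tail v x"
      using d(2,3) F by (metis less_eq_real_def) (use d(3) in simp)
    moreover have "f < tail v x \<longleftrightarrow> f < tail v y" if "f \<in> F" for f
      using assms(2) w(2) Suc.prems that unfolding same_cells_def by (meson Suc_le_lessD)
    ultimately have "real d / b < tail v y" "\<not> R / b + real d / b < tail v y"
      using F by auto
    then have "d \<in> digits (tail v y)"
      using d(1) gt_1 by (auto simp: digits_iff field_simps)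
    then show "w \<in> words (Suc j) y"
      unfolding w(1) snoc_in_words using Suc w(2) by auto
  qed
qed

lemma same_cells_words_eq:
  assumes "x \<in> regular" "y \<in> regular" "same_cells (Suc n) x y" "j \<le> Suc n"
  shows "words j x = words j y"
proof (rule antisym[OF same_cells_words_subset[OF assms(1,3,4)]])
  show "words j y \<subseteq> words j x"
    using assms(4)
  proof (induction j)
    case 0
    show ?case using regular_I[OF assms(1)] by auto
  next
    case (Suc j)
    show ?case
    proof
      fix w assume "w \<in> words (Suc j) y"
      then obtain v d where w: "w = v @ [d]" "v \<in> words j y" "d \<in> digits (tail v y)"
        by (rule snoc_words_cases)
      then have v: "v \<in> words j x" using Suc by auto
      have "cell_index (tail v x) = cell_index (tail v y)"
        using assms(3) v Suc.prems unfolding cell_index_eq_iff same_cells_def by (meson Suc_le_lessD)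
      moreover have "tail v x \<notin> F" "tail v y \<notin> F"
        using v w(2) assms(1,2) by (auto simp: regular_def)
      ultimately have "digits (tail v x) = digits (tail v y)" by (rule digits_eq_of_cell_index)
      then show "w \<in> words (Suc j) x"
        unfolding w(1) snoc_in_words using v w(3) by blast
    qed
  qed
qed

text \<open>Each comparison asks whether a threshold lies below \<open>y\<close>, so the solutions
  reach from the last threshold below \<open>x\<close>, excluded, to the first one above
  \<open>x\<close>, included. The empty word contributes 0 and \<open>R\<close>, so both thresholds
  exist.\<close>

lemma same_cells_interval:
  assumes "x \<in> regular"
  obtains u v w w' where "{y. same_cells (Suc n) x y} = {u<..v}" "u < v"
    "tail w u \<in> F" "tail w' v \<in> F" "set w \<subseteq> {..m}" "set w' \<subseteq> {..m}" "length w \<le> n" "length w' \<le> n"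
proof -
  define t where "t = (\<lambda>(w, f). (f - tail w 0) / b ^ length w)"
  define T where "T = (\<Union>j\<le>n. words j x) \<times> F"
  define \<Theta> where "\<Theta> = t ` T"
  have "finite \<Theta>"
    unfolding \<Theta>_def T_def using finite_words finite_partition_points by blast
  have t_less: "f < tail w y \<longleftrightarrow> t (w, f) < y" for w f y
    using gt_1 tail_affine[of w y] by (auto simp: t_def field_simps)
  have t_tail: "tail w (t (w, f)) = f" for w f
    using gt_1 tail_affine[of w "t (w, f)"] by (simp add: t_def)
  have B: "same_cells (Suc n) x y \<longleftrightarrow> (\<forall>\<theta>\<in>\<Theta>. \<theta> < x \<longleftrightarrow> \<theta> < y)" for y
    unfolding same_cells_def \<Theta>_def T_def t_less less_Suc_eq_le by blast
  have pre: "\<exists>w. tail w \<theta> \<in> F \<and> set w \<subseteq> {..m} \<and> length w \<le> n" if \<theta>: "\<theta> \<in> \<Theta>" for \<theta>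
  proof -
    obtain w f j where "j \<le> n" "w \<in> words j x" "f \<in> F" "\<theta> = t (w, f)"
      using \<theta> unfolding \<Theta>_def T_def by blast
    then show ?thesis using t_tail[of w f] by (intro exI[of _ w]) (auto simp: words_def)
  qed
  have "x \<noteq> \<theta>" if \<theta>: "\<theta> \<in> \<Theta>" for \<theta>
  proof
    assume "x = \<theta>"
    then obtain w f j where "w \<in> words j x" "f \<in> F" "x = t (w, f)"
      using \<theta> unfolding \<Theta>_def T_def by blast
    then have "tail w x \<in> F" using t_tail[of w f] by simp
    then show False using assms \<open>w \<in> words j x\<close> by (auto simp: regular_def)
  qed
  note ne = this
  have mem: "f \<in> \<Theta>" if "f \<in> F" for f
  proof -
    have "([], f) \<in> T" unfolding T_def using that regular_I[OF assms] by (auto intro!: bexI[of _ 0])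
    then have "t ([], f) \<in> \<Theta>" unfolding \<Theta>_def by (rule imageI)
    then show ?thesis by (simp add: t_def)
  qed
  have x: "0 < x" "x < R"
    using regular_I[OF assms] regular_not_F[OF assms] partition_points_mem(3,4)
    unfolding mem_I by (metis less_eq_real_def)+
  define Lo where "Lo = {\<theta>\<in>\<Theta>. \<theta> < x}"
  define Hi where "Hi = {\<theta>\<in>\<Theta>. x < \<theta>}"
  have fin: "finite Lo" "finite Hi" using \<open>finite \<Theta>\<close> by (auto simp: Lo_def Hi_def)
  have nonempty: "Lo \<noteq> {}" "Hi \<noteq> {}"
    using x mem partition_points_mem(3,4) unfolding Lo_def Hi_def by blast+
  have u: "Max Lo \<in> Lo" and v: "Min Hi \<in> Hi" using fin nonempty by auto
  have "same_cells (Suc n) x y \<longleftrightarrow> Max Lo < y \<and> y \<le> Min Hi" for y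
  proof
    assume "same_cells (Suc n) x y"
    then have *: "\<forall>\<theta>\<in>\<Theta>. \<theta> < x \<longleftrightarrow> \<theta> < y" by (simp add: B)
    have "Max Lo < y" using * u unfolding Lo_def by blast
    moreover have "\<not> Min Hi < y" using * v unfolding Hi_def by (blast dest: less_asym)
    ultimately show "Max Lo < y \<and> y \<le> Min Hi" by simp
  next
    assume y: "Max Lo < y \<and> y \<le> Min Hi"
    have "\<theta> < x \<longleftrightarrow> \<theta> < y" if \<theta>: "\<theta> \<in> \<Theta>" for \<theta>
    proof (cases "\<theta> < x")
      case True
      then have "\<theta> \<le> Max Lo" using \<theta> fin by (auto simp: Lo_def)
      then show ?thesis using True y by auto
    next
      case False
      then have "Min Hi \<le> \<theta>" using \<theta> fin ne[OF \<theta>] by (auto simp: Hi_def)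
      then show ?thesis using False y by auto
    qed
    then show "same_cells (Suc n) x y" by (simp add: B)
  qed
  then have eq: "{y. same_cells (Suc n) x y} = {Max Lo<..Min Hi}"
    by (simp only: greaterThanAtMost_def greaterThan_def atMost_def Int_def mem_Collect_eq)
  have "Max Lo < x" "Max Lo \<in> \<Theta>" using u unfolding Lo_def by blast+
  moreover have "x < Min Hi" "Min Hi \<in> \<Theta>" using v unfolding Hi_def by blast+
  ultimately have lt: "Max Lo < Min Hi" and \<Theta>: "Max Lo \<in> \<Theta>" "Min Hi \<in> \<Theta>" by auto
  obtain w w' where "tail w (Max Lo) \<in> F" "set w \<subseteq> {..m}" "length w \<le> n"
    "tail w' (Min Hi) \<in> F" "set w' \<subseteq> {..m}" "length w' \<le> n"
    using pre[OF \<Theta>(1)] pre[OF \<Theta>(2)] by blast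
  then show ?thesis using that[OF eq lt] by blast
qed

text \<open>Measurability of \<open>A\<close> is part of what is obtained: it differs from a Borel
  set by countable sets. This is how balls of the fibre metric are handled.\<close>

lemma mu_eq_mod_countable:
  assumes "B \<in> sets borel" "countable (A - B)" "countable (B - A)"
  shows "measure mu A = measure mu B"
proof -
  have bor: "A - B \<in> sets borel" "B - A \<in> sets borel"
    by (rule sets.countable[OF _ assms(2)] sets.countable[OF _ assms(3)], simp)+
  have A_eq: "A = (B - (B - A)) \<union> (A - B)" by blast
  have A: "A \<in> sets borel" by (subst A_eq) (use assms(1) bor in blast)
  have "measure mu A \<le> measure mu (B \<union> (A - B))"
    using sets.Un[OF assms(1) bor(1)] by (intro mu.finite_measure_mono) auto
  also have "\<dots> \<le> measure mu B + measure mu (A - B)"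
    using assms(1) bor by (intro measure_Un_le) auto
  finally have 1: "measure mu A \<le> measure mu B" by (simp add: mu_countable[OF assms(2)])
  have "measure mu B \<le> measure mu (A \<union> (B - A))"
    using sets.Un[OF A bor(2)] by (intro mu.finite_measure_mono) auto
  also have "\<dots> \<le> measure mu A + measure mu (B - A)"
    using A bor by (intro measure_Un_le) auto
  finally have 2: "measure mu B \<le> measure mu A" by (simp add: mu_countable[OF assms(3)])
  from 1 2 show ?thesis by simp
qed

text \<open>For a word that does not belong to \<open>x\<close>, the image of the interval meets the
  support only in images of irregular points, which are countably many. Every other word contributes
  at most 1.\<close>

lemma mu_same_cells_upper:
  assumes x: "x \<in> regular"
  shows "measure mu {y. same_cells (Suc n) x y} \<le> card (words (Suc n) x) / (real m + 1) ^ Suc n"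
proof -
  define B where "B = {y. same_cells (Suc n) x y}"
  have B: "B \<in> sets borel"
    using same_cells_interval[OF x, of n] unfolding B_def by (metis borel_measurable_vimage greaterThanAtMost_borel)
  have sub: "words (Suc n) x \<subseteq> all_words (Suc n)" by (auto simp: words_def all_words_def)
  have null: "measure mu (tail w ` B) = 0" if w: "w \<in> all_words (Suc n) - words (Suc n) x" for w
  proof -
    have C: "countable (tail w ` (B - regular))"
    proof -
      have "B - regular \<subseteq> I - regular" using same_cells_in_I[OF x] unfolding B_def by blast
      then show ?thesis using countable_irregular countable_subset by blast
    qed
    have "tail w y \<notin> I" if "y \<in> B" "y \<in> regular" for y
      using same_cells_words_eq[OF x that(2), of n "Suc n"] that(1) w
      by (auto simp: B_def words_def all_words_def)
    then have "(tail w ` B - tail w ` (B - regular)) \<inter> I = {}" by blast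
    then have "measure mu (tail w ` B - tail w ` (B - regular)) = 0" by (rule mu_complement_I)
    moreover have "measure mu (tail w ` B) = measure mu (tail w ` B - tail w ` (B - regular))"
    proof (rule mu_eq_mod_countable)
      show "tail w ` B - tail w ` (B - regular) \<in> sets borel"
        by (rule sets.Diff[OF tail_image_borel[OF B] sets.countable[OF _ C]]) simp
      show "countable (tail w ` B - (tail w ` B - tail w ` (B - regular)))"
        by (rule countable_subset[OF _ C]) blast
      show "countable ((tail w ` B - tail w ` (B - regular)) - tail w ` B)"
        by (rule countable_subset[OF _ C]) blast
    qed
    ultimately show ?thesis by simp
  qed
  have "(\<Sum>w\<in>all_words (Suc n). measure mu (tail w ` B)) = (\<Sum>w\<in>words (Suc n) x. measure mu (tail w ` B))"
    using sub null finite_all_words by (intro sum.mono_neutral_right) auto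
  also have "\<dots> \<le> of_nat (card (words (Suc n) x)) * 1"
    by (intro sum_bounded_above) auto
  finally show ?thesis
    unfolding B_def[symmetric] mu_self_similar_words[OF B, of "Suc n"]
    by (intro divide_right_mono) auto
qed

text \<open>Every word of \<open>x\<close> of length \<open>Suc n\<close> is a word of all points of
  the interval, so it maps the interval into the expansion interval and stretches it to a length
  bounded below.\<close>

lemma mu_same_cells_lower:
  "\<exists>c>0. \<forall>x\<in>regular. \<forall>n. c * (card (words (Suc n) x) / (real m + 1) ^ Suc n)
      \<le> measure mu {y. same_cells (Suc n) x y}"
proof -
  obtain c where c: "c > 0"
    "\<And>u v w w' n. \<lbrakk>tail w u \<in> F; tail w' v \<in> F; set w \<subseteq> {..m}; set w' \<subseteq> {..m};
      length w \<le> n; length w' \<le> n; u \<noteq> v\<rbrakk> \<Longrightarrow> c \<le> b ^ n * \<bar>u - v\<bar>"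
    using preimages_separated by blast
  obtain c' where c': "c' > 0" "\<And>u v. u \<in> I \<Longrightarrow> v \<in> I \<Longrightarrow> c / 2 \<le> v - u \<Longrightarrow> c' \<le> measure mu {u<..<v}"
    using mu_interval_ge[of "c / 2"] c(1) by auto
  have "c' * (card (words (Suc n) x) / (real m + 1) ^ Suc n) \<le> measure mu {y. same_cells (Suc n) x y}"
    if x: "x \<in> regular" for x n
  proof -
    obtain u v s s' where uv: "{y. same_cells (Suc n) x y} = {u<..v}" "u < v"
      "tail s u \<in> F" "tail s' v \<in> F" "set s \<subseteq> {..m}" "set s' \<subseteq> {..m}" "length s \<le> n" "length s' \<le> n"
      using same_cells_interval[OF x, of n] by metis
    have len: "c \<le> b ^ n * (v - u)"
      using c(2)[OF uv(3-8)] uv(2) by simp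
    have ge: "c' \<le> measure mu (tail w ` {u<..v})" if w: "w \<in> words (Suc n) x" for w
    proof -
      \<comment> \<open>The left endpoint is excluded, so its tail is not known to stay in the
        expansion interval. The midpoint replaces it at the price of the factor in
        \<open>c / 2\<close>.\<close>
      define u' where "u' = (u + v) / 2"
      have u': "u < u'" "u' < v" using uv(2) by (auto simp: u'_def)
      have wl: "length w = Suc n" using w by (simp add: words_def)
      have "tail w y \<in> I" if "y \<in> {u<..v}" for y
        using same_cells_words_subset[OF x, of n y "Suc n"] that w unfolding uv(1)[symmetric]
        by (auto simp: words_def)
      then have "tail w u' \<in> I" "tail w v \<in> I" using u' by auto
      moreover have "c / 2 \<le> tail w v - tail w u'"
      proof -
        have "c \<le> b ^ n * (v - u)" by (rule len)
        also have "\<dots> \<le> b ^ Suc n * (v - u)"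
          using gt_1 uv(2) by (intro mult_right_mono power_increasing) auto
        also have "\<dots> = 2 * (tail w v - tail w u')"
          unfolding tail_diff wl u'_def by (simp add: field_simps)
        finally show ?thesis by simp
      qed
      ultimately have "c' \<le> measure mu {tail w u'<..<tail w v}" by (rule c'(2))
      also have "\<dots> \<le> measure mu (tail w ` {u<..v})"
      proof (rule mu.finite_measure_mono)
        show "{tail w u'<..<tail w v} \<subseteq> tail w ` {u<..v}"
        proof
          fix z assume z: "z \<in> {tail w u'<..<tail w v}"
          define y where "y = (z - tail w 0) / b ^ length w"
          have y: "tail w y = z" unfolding y_def using gt_1 by (subst tail_affine) simp
          then have "u' < y" "y < v"
            using z tail_less_iff[of w u' y] tail_less_iff[of w y v] by auto
          then show "z \<in> tail w ` {u<..v}" using y u' by (intro image_eqI[of _ _ y]) auto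
        qed
        show "tail w ` {u<..v} \<in> mu.events" using tail_image_borel[of "{u<..v}" w] by simp
      qed
      finally show ?thesis .
    qed
    have "c' * real (card (words (Suc n) x)) = (\<Sum>w\<in>words (Suc n) x. c')" by simp
    also have "\<dots> \<le> (\<Sum>w\<in>words (Suc n) x. measure mu (tail w ` {u<..v}))"
      by (rule sum_mono) (rule ge)
    also have "\<dots> \<le> (\<Sum>w\<in>all_words (Suc n). measure mu (tail w ` {u<..v}))"
      by (rule sum_mono2[OF finite_all_words]) (auto simp: words_def all_words_def)
    finally have "c' * real (card (words (Suc n) x)) / (real m + 1) ^ Suc n \<le> measure mu {u<..v}"
      unfolding mu_self_similar_words[OF greaterThanAtMost_borel, of u v "Suc n"]
      by (intro divide_right_mono) auto
    then show ?thesis unfolding uv(1) by simp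
  qed
  then show ?thesis using c'(1) by blast
qed

lemma mu_ball:
  assumes x: "x \<in> regular" and r: "1 / b ^ Suc n < r" "r \<le> 1 / b ^ n"
  shows "measure mu (open_ball (regular_interval b) (fibre_dist b) x r) =
    measure mu {y. same_cells (Suc n) x y}" (is "measure mu ?A = measure mu ?B")
proof (rule mu_eq_mod_countable)
  obtain u v where "?B = {u<..v}" using same_cells_interval[OF x, of n] by metis
  then show "?B \<in> sets borel" by simp
  have "?A - ?B \<subseteq> {0, R}"
    using fibre_dist_less_iff[OF x _ r] unfolding open_ball_def regular_interval_eq by blast
  then show "countable (?A - ?B)" using countable_finite finite_subset by blast
  have "?B - ?A \<subseteq> I - regular"
    using fibre_dist_less_iff[OF x _ r] same_cells_in_I[OF x, of n]
    unfolding open_ball_def regular_interval_eq by blast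
  then show "countable (?B - ?A)" using countable_irregular countable_subset by blast
qed

section \<open>Passage to the limit\<close>

lemma scale_exists:
  assumes "0 < r" "r \<le> 1"
  obtains n where "1 / b ^ Suc n < r" "r \<le> 1 / b ^ n"
proof -
  obtain k where "1 / r < b ^ k" using real_arch_pow gt_1 by blast
  then have k: "1 / b ^ k < r" using assms gt_1 by (simp add: field_simps)
  define N where "N = (LEAST k. 1 / b ^ k < r)"
  have N: "1 / b ^ N < r" unfolding N_def using k by (rule LeastI)
  have "N \<noteq> 0"
  proof
    assume "N = 0"
    then show False using N assms by simp
  qed
  then obtain n where n: "N = Suc n" by (cases N) auto
  have "\<not> 1 / b ^ n < r" using not_less_Least[of n "\<lambda>k. 1 / b ^ k < r"] n unfolding N_def by simp
  then show ?thesis using that[of n] N unfolding n by simp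
qed

text \<open>Numerator and denominator are both divided by minus the number of codes at the scale of
  \<open>r\<close>. Constant factors in the mass then vanish in the limit, as does the ambiguity of
  \<open>r\<close> within one scale.\<close>

lemma local_dimension:
  assumes x: "x \<in> regular"
    and lim: "(\<lambda>k. ln (real (expansion_count b k x)) / real k) \<longlonglongrightarrow> \<gamma>"
  shows "has_local_dimension (regular_interval b) (fibre_dist b) mu x ((ln (real m + 1) - \<gamma>) / ln b)"
proof -
  define g where "g r = measure mu (open_ball (regular_interval b) (fibre_dist b) x r)" for r
  define p where "p N = card (words N x) / (real m + 1) ^ N" for N
  have p_pos: "p N > 0" for N
    using words_nonempty[OF regular_I[OF x]] finite_words by (simp add: p_def card_gt_0_iff)
  obtain c where c: "c > 0" "\<And>n. c * p (Suc n) \<le> measure mu {y. same_cells (Suc n) x y}"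
    using mu_same_cells_lower x unfolding p_def by blast
  have bounds: "c * p (Suc n) \<le> g r" "g r \<le> p (Suc n)"
    if "1 / b ^ Suc n < r" "r \<le> 1 / b ^ n" for n r
    using c(2)[of n] mu_same_cells_upper[OF x, of n] mu_ball[OF x that] by (auto simp: g_def p_def)
  have g_pos: "g r > 0" if "r > 0" for r
  proof (cases "r \<le> 1")
    case True
    then obtain n where n: "1 / b ^ Suc n < r" "r \<le> 1 / b ^ n"
      using scale_exists \<open>r > 0\<close> by blast
    have "0 < c * p (Suc n)" using c(1) p_pos by simp
    then show ?thesis using bounds(1)[OF n] by linarith
  next
    \<comment> \<open>Positivity is demanded for large radii too; beyond 1 the ball contains every
      regular point and so has full mass.\<close>
    case False
    let ?A = "open_ball (regular_interval b) (fibre_dist b) x r"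
    have "regular \<subseteq> ?A"
    proof
      fix y assume y: "y \<in> regular"
      obtain \<epsilon> where \<epsilon>: "1 < \<epsilon>" "\<epsilon> < r" using dense False by (meson not_le)
      have "fibre_dist b x y \<le> \<epsilon>"
        using fibre_dist_le[OF x y, of 0 \<epsilon>] \<epsilon>(1) by (simp add: same_cells_def)
      then show "y \<in> ?A" using \<epsilon> y by (simp add: open_ball_def regular_interval_eq)
    qed
    then have "I - ?A \<subseteq> I - regular" by blast
    then have "countable (I - ?A)" using countable_irregular countable_subset by blast
    moreover have "?A - I = {}"
      using right_end_gt_1 by (auto simp: open_ball_def regular_interval_eq mem_I regular_def)
    ultimately have "measure mu ?A = measure mu I"
      by (intro mu_eq_mod_countable) (simp_all only: countable_empty, simp add: expansion_interval_def)
    then show ?thesis by (simp add: g_def mu_I)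
  qed
  define N where "N r = (SOME n. 1 / b ^ Suc n < r \<and> r \<le> 1 / b ^ n)" for r
  have N: "1 / b ^ Suc (N r) < r" "r \<le> 1 / b ^ N r" if "0 < r" "r < 1" for r
  proof -
    have "\<exists>n. 1 / b ^ Suc n < r \<and> r \<le> 1 / b ^ n"
      using scale_exists[of r] that by (metis less_imp_le)
    from someI_ex[OF this] show "1 / b ^ Suc (N r) < r" "r \<le> 1 / b ^ N r"
      unfolding N_def by auto
  qed
  have ev01: "\<forall>\<^sub>F r in at_right (0::real). 0 < r \<and> r < 1"
    unfolding eventually_at_right_field by (intro exI[of _ 1]) auto
  have N_lim: "filterlim (\<lambda>r. Suc (N r)) at_top (at_right 0)"
    unfolding filterlim_at_top
  proof
    fix Z
    have "\<forall>\<^sub>F r in at_right (0::real). 0 < r \<and> r < 1 / b ^ Z"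
      unfolding eventually_at_right_field using gt_1 by (intro exI[of _ "1 / b ^ Z"]) auto
    then show "\<forall>\<^sub>F r in at_right 0. Z \<le> Suc (N r)"
      using ev01
    proof eventually_elim
      case (elim r)
      then have "1 / b ^ Suc (N r) < 1 / b ^ Z" using N(1)[of r] by simp
      then have "b ^ Z < b ^ Suc (N r)" using gt_1 by (simp add: field_simps)
      then show ?case using gt_1 by (simp only: power_strict_increasing_iff less_imp_le)
    qed
  qed
  have lb: "ln b > 0" using gt_1 by simp
  \<comment> \<open>For k > 0 this equals \<open>ln (real m + 1)\<close> minus the exponential
    growth rate of the number of words.\<close>
  define a where "a k = - ln (p k) / real k" for k
  have a_lim: "a \<longlonglongrightarrow> ln (real m + 1) - \<gamma>"
  proof (rule Lim_transform_eventually)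
    show "(\<lambda>k. ln (real m + 1) - ln (real (expansion_count b k x)) / real k) \<longlonglongrightarrow> ln (real m + 1) - \<gamma>"
      by (intro tendsto_diff tendsto_const lim)
    show "\<forall>\<^sub>F k in sequentially. ln (real m + 1) - ln (real (expansion_count b k x)) / real k = a k"
      using eventually_gt_at_top[of 0]
    proof eventually_elim
      case (elim k)
      have "card (words k x) > 0"
        using words_nonempty[OF regular_I[OF x]] finite_words by (simp add: card_gt_0_iff)
      then have "ln (p k) = ln (real (card (words k x))) - real k * ln (real m + 1)"
        unfolding p_def by (subst ln_divide_pos) (auto simp: ln_realpow)
      then show ?case
        using elim unfolding a_def expansion_count_eq_card_words[OF regular_I[OF x]]
        by (simp add: diff_divide_distrib)
    qed
  qed
  have inv_lim: "(\<lambda>k. t / real k) \<longlonglongrightarrow> 0" for t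
    by (rule lim_const_over_n)
  have "((\<lambda>r. - ln (g r) / real (Suc (N r))) \<longlongrightarrow> ln (real m + 1) - \<gamma>) (at_right 0)"
  proof (rule tendsto_sandwich)
    show "((\<lambda>r. a (Suc (N r))) \<longlongrightarrow> ln (real m + 1) - \<gamma>) (at_right 0)"
      by (rule filterlim_compose[OF a_lim N_lim])
    have "(\<lambda>k. a k - ln c / real k) \<longlonglongrightarrow> (ln (real m + 1) - \<gamma>) - 0"
      by (intro tendsto_diff a_lim inv_lim)
    from filterlim_compose[OF this N_lim]
    show "((\<lambda>r. a (Suc (N r)) - ln c / real (Suc (N r))) \<longlongrightarrow> ln (real m + 1) - \<gamma>) (at_right 0)"
      by simp
    show "\<forall>\<^sub>F r in at_right 0. a (Suc (N r)) \<le> - ln (g r) / real (Suc (N r))"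
      using ev01
    proof eventually_elim
      case (elim r)
      then have "ln (g r) \<le> ln (p (Suc (N r)))"
        using bounds(2)[OF N, of r] g_pos by (intro ln_mono) auto
      then show ?case unfolding a_def by (intro divide_right_mono) auto
    qed
    show "\<forall>\<^sub>F r in at_right 0. - ln (g r) / real (Suc (N r)) \<le> a (Suc (N r)) - ln c / real (Suc (N r))"
      using ev01
    proof eventually_elim
      case (elim r)
      have "ln c + ln (p (Suc (N r))) = ln (c * p (Suc (N r)))"
        using c(1) p_pos by (simp add: ln_mult_pos)
      also have "\<dots> \<le> ln (g r)"
        using bounds(1)[OF N, of r] elim c(1) p_pos by (intro ln_mono) auto
      finally have "- ln (g r) \<le> - ln (p (Suc (N r))) - ln c" by simp
      then have "- ln (g r) / real (Suc (N r)) \<le> (- ln (p (Suc (N r))) - ln c) / real (Suc (N r))"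
        by (intro divide_right_mono) auto
      then show ?case unfolding a_def by (simp add: diff_divide_distrib)
    qed
  qed
  moreover have "((\<lambda>r. - ln r / real (Suc (N r))) \<longlongrightarrow> ln b) (at_right 0)"
  proof (rule tendsto_sandwich)
    have "(\<lambda>k. ln b - ln b / real k) \<longlonglongrightarrow> ln b - 0"
      by (intro tendsto_diff tendsto_const inv_lim)
    from filterlim_compose[OF this N_lim]
    show "((\<lambda>r. ln b - ln b / real (Suc (N r))) \<longlongrightarrow> ln b) (at_right 0)" by simp
    show "((\<lambda>r. ln b) \<longlongrightarrow> ln b) (at_right 0)" by simp
    show "\<forall>\<^sub>F r in at_right 0. ln b - ln b / real (Suc (N r)) \<le> - ln r / real (Suc (N r))"
      using ev01
    proof eventually_elim
      case (elim r)
      have "ln r \<le> ln (1 / b ^ N r)" using N(2) elim gt_1 by (intro ln_mono) auto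
      also have "\<dots> = - (real (N r) * ln b)" using gt_1 by (simp add: ln_div ln_realpow)
      finally have "real (Suc (N r)) * ln b - ln b \<le> - ln r" by (simp add: algebra_simps)
      then have "(real (Suc (N r)) * ln b - ln b) / real (Suc (N r)) \<le> - ln r / real (Suc (N r))"
        by (intro divide_right_mono) auto
      then show ?case by (simp add: diff_divide_distrib del: of_nat_Suc)
    qed
    show "\<forall>\<^sub>F r in at_right 0. - ln r / real (Suc (N r)) \<le> ln b"
      using ev01
    proof eventually_elim
      case (elim r)
      have "ln (1 / b ^ Suc (N r)) \<le> ln r" using N(1)[of r] elim gt_1 by (intro ln_mono) auto
      moreover have "ln (1 / b ^ Suc (N r)) = - (real (Suc (N r)) * ln b)"
        using gt_1 by (simp add: ln_div ln_realpow del: power_Suc)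
      ultimately have "- ln r \<le> real (Suc (N r)) * ln b" by simp
      then show ?case by (subst pos_divide_le_eq) (auto simp: mult.commute)
    qed
  qed
  ultimately have "((\<lambda>r. (- ln (g r) / real (Suc (N r))) / (- ln r / real (Suc (N r))))
      \<longlongrightarrow> (ln (real m + 1) - \<gamma>) / ln b) (at_right 0)"
    using lb by (intro tendsto_divide) auto
  then have "((\<lambda>r. ln (g r) / ln r) \<longlongrightarrow> (ln (real m + 1) - \<gamma>) / ln b) (at_right 0)"
    by (simp del: of_nat_Suc)
  then show ?thesis
    using g_pos x unfolding has_local_dimension_def g_def regular_interval_eq by auto
qed

end

text \<open>For an integer base the first greedy digit of 1 is the base itself and leaves remainder
  0, so the second digit would be 0.\<close>

lemma generalised_multinacci_not_Int:
  assumes "generalised_multinacci b"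
  shows "b \<notin> \<int>"
proof
  assume "b \<in> \<int>"
  then obtain k where k: "b = of_int k" by (auto elim: Ints_cases)
  obtain n where n: "n \<ge> 2" "\<And>j. j < n \<Longrightarrow> greedy_digits b 1 j \<ge> 1" and b: "b > 1"
    using assms unfolding generalised_multinacci_def by blast
  have m: "real (max_digit b) = b" using b by (simp add: max_digit_def k)
  then have "greedy_map b 1 = 0" using b by (simp add: greedy_map_def greedy_digit_def)
  then have "greedy_digits b 1 1 = 0"
    using b m by (simp add: greedy_digits_def greedy_digit_def)
  then show False using n(1) n(2)[of 1] by simp
qed

theorem corollary4p2:
  fixes \<beta> \<gamma> :: real
  assumes "generalised_multinacci \<beta>"
    and "pisot_number \<beta>"
    and "AE x in lebesgue_on (expansion_interval \<beta>).
           (\<lambda>k. ln (real (expansion_count \<beta> k x)) / real k) \<longlonglongrightarrow> \<gamma>"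
  shows "AE x in lebesgue_on (expansion_interval \<beta>).
           has_local_dimension (regular_interval \<beta>) (fibre_dist \<beta>) (bernoulli_convolution \<beta>) x
             ((ln (real_of_int \<lceil>\<beta>\<rceil>) - \<gamma>) / ln \<beta>)"
proof -
  interpret noninteger_pisot \<beta>
    using assms(2) generalised_multinacci_not_Int[OF assms(1)] by unfold_locales
  have c: "real_of_int \<lceil>\<beta>\<rceil> = real (max_digit \<beta>) + 1" by (simp add: ceiling_eq)
  show ?thesis
    using assms(3) AE_regular unfolding c
    by eventually_elim (rule local_dimension)
qed

end
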